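(* Let $G$ be a finite simple graph and let $\overline{G}$ denote its complement. The following three properties are equivalent: (i) $G$ is (wheel, antiwheel)-free, i.e., no induced subgraph of $G$ is isomorphic to a wheel or to an antiwheel; (ii) $G$ has no induced subgraph on at most seven vertices that is isomorphic to a wheel or to an antiwheel; (iii) $G$ or $\overline{G}$ is either a $5$-hole (i.e., isomorphic to the cycle $C_5$), a $6$-hole (i.e., isomorphic to $C_6$), a split graph, or a member of $\mathcal{A}\cup\mathcal{B}\cup\mathcal{C}$.
   Context: All graphs are finite and simple. A hole is a chordless (induced) cycle of length at least $4$; a $k$-hole is a hole on $k$ vertices. A wheel is a graph consisting of a chordless cycle of length at least $4$ together with one additional vertex that has at least three neighbors on the cycle. An antiwheel is the complement of a wheel. A graph is $\mathcal{F}$-free if it has no induced subgraph isomorphic to a member of $\mathcal{F}$. A set $S$ is complete (resp. anticomplete) to a set $T$ if every vertex of $S$ is adjacent (resp. non-adjacent) to every vertex of $T$. A graph is split if its vertex set can be partitioned into a stable set and a clique. $P_5$ denotes the path on $5$ vertices. Class $\mathcal{A}$: $G\in\mathcal{A}$ if $V(G)$ can be partitioned into two sets $\{a,b,c,d,e\}$ (five distinct vertices) and $X$ such that: $\{a,b,c,d\}$ induces a hole with edges $ab,bc,cd,da$; $X$ is non-empty, is a clique, is complete to $\{c,d\}$ and anticomplete to $\{a,b\}$; $e$ is complete to $X$, anticomplete to $\{a,b\}$, and has at most one neighbor in $\{c,d\}$. Class $\mathcal{B}$: $G\in\mathcal{B}$ if $V(G)$ can be partitioned into four stable sets $X,Y,Z,W$,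 with two special vertices $x\in X$ and $y\in Y$, such that: $|X|\ge 2$, $|Y|\ge 2$, and $X\cup Y$ induces a connected $P_5$-free bipartite graph; $W$ is anticomplete to $X\cup Y\cup Z$; $x$ is complete to $Y$ and $y$ is complete to $X$; $Z$ is complete to $\{x,y\}$ and anticomplete to $(X\cup Y)\setminus\{x,y\}$. Class $\mathcal{C}$: $G\in\mathcal{C}$ if $V(G)$ can be partitioned into two cliques $X$ and $Y$, each of size at least $2$, such that the set of edges between $X$ and $Y$ forms a matching of size exactly $2$. *)

theory Defs
  imports "Graph_Theory.Digraph_Component" "Graph_Theory.Digraph_Isomorphism"
begin

text \<open>
  A finite simple graph is a digraph satisfying the locale predicate \<^const>\<open>graph\<close> (finite,
  loop-free, no parallel arcs, symmetric); an undirected edge is a pair of opposite arcs.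
\<close>

definition complement :: "('a,'b) pre_digraph \<Rightarrow> ('a, 'a \<times> 'a) pre_digraph" where
  "complement G = with_proj \<lparr> pverts = verts G,
     parcs = {(u,v). u \<in> verts G \<and> v \<in> verts G \<and> u \<noteq> v \<and> \<not> u \<rightarrow>\<^bsub>G\<^esub> v} \<rparr>"

definition cycle_graph :: "nat \<Rightarrow> nat pair_pre_digraph" where
  "cycle_graph n = \<lparr> pverts = {..<n},
     parcs = {(i,j). i < n \<and> j < n \<and> (j = Suc i mod n \<or> i = Suc j mod n)} \<rparr>"

definition path_graph :: "nat \<Rightarrow> nat pair_pre_digraph" where
  "path_graph n = \<lparr> pverts = {..<n},
     parcs = {(i,j). i < n \<and> j < n \<and> (j = Suc i \<or> i = Suc j)} \<rparr>"

text \<open>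
  \<open>is_hole k G\<close>: the whole graph \<open>G\<close> is a hole on \<open>k\<close> vertices.
\<close>

definition is_hole :: "nat \<Rightarrow> ('a,'b) pre_digraph \<Rightarrow> bool" where
  "is_hole k G \<longleftrightarrow> graph G \<and> 4 \<le> k \<and> digraph_iso G (with_proj (cycle_graph k))"

definition is_wheel :: "('a,'b) pre_digraph \<Rightarrow> bool" where
  "is_wheel G \<longleftrightarrow> graph G \<and>
     (\<exists>h \<in> verts G. (\<exists>k. is_hole k (G \<restriction> (verts G - {h}))) \<and>
        3 \<le> card {v \<in> verts G - {h}. h \<rightarrow>\<^bsub>G\<^esub> v})"

definition is_antiwheel :: "('a,'b) pre_digraph \<Rightarrow> bool" where
  "is_antiwheel G \<longleftrightarrow> graph G \<and> is_wheel (complement G)"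

text \<open>
  A family of forbidden graphs is given as an isomorphism-invariant predicate \<open>F\<close>, so that
  ``isomorphic to a member of the family'' is just \<open>F H\<close>.
\<close>

definition free_of :: "(('a,'b) pre_digraph \<Rightarrow> bool) \<Rightarrow> ('a,'b) pre_digraph \<Rightarrow> bool" where
  "free_of F G \<longleftrightarrow> \<not> (\<exists>H. induced_subgraph H G \<and> F H)"

definition complete_to :: "('a,'b) pre_digraph \<Rightarrow> 'a set \<Rightarrow> 'a set \<Rightarrow> bool" where
  "complete_to G S T \<longleftrightarrow> (\<forall>s \<in> S. \<forall>t \<in> T. s \<rightarrow>\<^bsub>G\<^esub> t)"

definition anticomplete_to :: "('a,'b) pre_digraph \<Rightarrow> 'a set \<Rightarrow> 'a set \<Rightarrow> bool" where
  "anticomplete_to G S T \<longleftrightarrow> (\<forall>s \<in> S. \<forall>t \<in> T. \<not> s \<rightarrow>\<^bsub>G\<^esub> t)"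

definition clique :: "('a,'b) pre_digraph \<Rightarrow> 'a set \<Rightarrow> bool" where
  "clique G S \<longleftrightarrow> S \<subseteq> verts G \<and> (\<forall>u \<in> S. \<forall>v \<in> S. u \<noteq> v \<longrightarrow> u \<rightarrow>\<^bsub>G\<^esub> v)"

definition stable :: "('a,'b) pre_digraph \<Rightarrow> 'a set \<Rightarrow> bool" where
  "stable G S \<longleftrightarrow> S \<subseteq> verts G \<and> (\<forall>u \<in> S. \<forall>v \<in> S. \<not> u \<rightarrow>\<^bsub>G\<^esub> v)"

definition split_graph :: "('a,'b) pre_digraph \<Rightarrow> bool" where
  "split_graph G \<longleftrightarrow> graph G \<and>
     (\<exists>S K. verts G = S \<union> K \<and> S \<inter> K = {} \<and> stable G S \<and> clique G K)"

definition bipartite :: "('a,'b) pre_digraph \<Rightarrow> bool" where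
  "bipartite G \<longleftrightarrow> graph G \<and>
     (\<exists>S T. verts G = S \<union> T \<and> S \<inter> T = {} \<and> stable G S \<and> stable G T)"

definition class_A :: "('a,'b) pre_digraph \<Rightarrow> bool" where
  "class_A G \<longleftrightarrow> graph G \<and>
     (\<exists>a b c d e X.
        distinct [a, b, c, d, e] \<and>
        verts G = {a, b, c, d, e} \<union> X \<and> {a, b, c, d, e} \<inter> X = {} \<and>
        arcs_ends (G \<restriction> {a, b, c, d}) = symcl {(a,b), (b,c), (c,d), (d,a)} \<and>
        X \<noteq> {} \<and> clique G X \<and> complete_to G X {c, d} \<and> anticomplete_to G X {a, b} \<and>
        complete_to G {e} X \<and> anticomplete_to G {e} {a, b} \<and>
        card {v \<in> {c, d}. e \<rightarrow>\<^bsub>G\<^esub> v} \<le> 1)"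

definition class_B :: "('a,'b) pre_digraph \<Rightarrow> bool" where
  "class_B G \<longleftrightarrow> graph G \<and>
     (\<exists>X Y Z W x y.
        verts G = X \<union> Y \<union> Z \<union> W \<and>
        X \<inter> Y = {} \<and> X \<inter> Z = {} \<and> X \<inter> W = {} \<and> Y \<inter> Z = {} \<and> Y \<inter> W = {} \<and> Z \<inter> W = {} \<and>
        stable G X \<and> stable G Y \<and> stable G Z \<and> stable G W \<and>
        x \<in> X \<and> y \<in> Y \<and> 2 \<le> card X \<and> 2 \<le> card Y \<and>
        connected (G \<restriction> (X \<union> Y)) \<and> bipartite (G \<restriction> (X \<union> Y)) \<and>
        free_of (\<lambda>H. digraph_iso H (with_proj (path_graph 5))) (G \<restriction> (X \<union> Y)) \<and>
        anticomplete_to G W (X \<union> Y \<union> Z) \<and>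
        complete_to G {x} Y \<and> complete_to G {y} X \<and>
        complete_to G Z {x, y} \<and> anticomplete_to G Z ((X \<union> Y) - {x, y}))"

definition edges_between :: "('a,'b) pre_digraph \<Rightarrow> 'a set \<Rightarrow> 'a set \<Rightarrow> 'a set set" where
  "edges_between G X Y = {{u, v} | u v. u \<in> X \<and> v \<in> Y \<and> u \<rightarrow>\<^bsub>G\<^esub> v}"

definition class_C :: "('a,'b) pre_digraph \<Rightarrow> bool" where
  "class_C G \<longleftrightarrow> graph G \<and>
     (\<exists>X Y. verts G = X \<union> Y \<and> X \<inter> Y = {} \<and> clique G X \<and> clique G Y \<and>
        2 \<le> card X \<and> 2 \<le> card Y \<and>
        pairwise disjnt (edges_between G X Y) \<and> card (edges_between G X Y) = 2)"

definition basic :: "('a,'b) pre_digraph \<Rightarrow> bool" where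
  "basic G \<longleftrightarrow> is_hole 5 G \<or> is_hole 6 G \<or> split_graph G \<or> class_A G \<or> class_B G \<or> class_C G"

end

theory Submission
  imports Defs
begin

text \<open>
  A wheel or antiwheel on at most seven vertices is excluded exactly when five local rules hold:
  a vertex outside a 4-hole has at most two neighbours on it; a vertex outside an induced
  \<open>2K\<^sub>2\<close> has at least two neighbours in it; and a 5-hole, a 6-hole or the complement of a 6-hole
  is the whole graph. A hole of length at least seven contains a \<open>2K\<^sub>2\<close> and a further vertex with
  at most one neighbour in it, so the rules exclude all wheels, and they are invariant under
  complementation.

  Let \<open>G\<close> satisfy the rules and contain none of the three exceptional graphs. Without 4-holes and
  without \<open>2K\<^sub>2\<close> it is split, by induction on the number of vertices: the non-neighbours of a
  vertex of maximum degree form a stable set, so that the vertex fits into a split partition of the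
  rest. With a 4-hole but without \<open>2K\<^sub>2\<close>, an edge \<open>ab\<close> of a 4-hole, lying in a triangle if
  possible and of maximum degree sum otherwise, exhibits \<open>G\<close> as a member of the class \<open>B\<close>, the
  four parts being read off from the adjacency to \<open>a\<close> and \<open>b\<close>. With both, a 4-hole and a \<open>2K\<^sub>2\<close>
  can be chosen to share two vertices, adjacent ones up to complementation; the six vertices then
  determine how every other vertex attaches, and \<open>G\<close> is in \<open>A\<close> or \<open>C\<close>, or its complement in \<open>C\<close>.
\<close>

section \<open>Adjacency relations and induced patterns\<close>

definition induced_C4 :: "('a \<Rightarrow> 'a \<Rightarrow> bool) \<Rightarrow> 'a \<Rightarrow> 'a \<Rightarrow> 'a \<Rightarrow> 'a \<Rightarrow> bool" where
  "induced_C4 E a b c d \<longleftrightarrow> E a b \<and> E b c \<and> E c d \<and> E d a \<and> \<not> E a c \<and> \<not> E b d \<and> a \<noteq> c \<and> b \<noteq> d"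

definition induced_2K2 :: "('a \<Rightarrow> 'a \<Rightarrow> bool) \<Rightarrow> 'a \<Rightarrow> 'a \<Rightarrow> 'a \<Rightarrow> 'a \<Rightarrow> bool" where
  "induced_2K2 E p q r s \<longleftrightarrow> E p q \<and> E r s \<and> \<not> E p r \<and> \<not> E p s \<and> \<not> E q r \<and> \<not> E q s"

definition induced_C5 :: "('a \<Rightarrow> 'a \<Rightarrow> bool) \<Rightarrow> 'a \<Rightarrow> 'a \<Rightarrow> 'a \<Rightarrow> 'a \<Rightarrow> 'a \<Rightarrow> bool" where
  "induced_C5 E a b c d e \<longleftrightarrow> E a b \<and> E b c \<and> E c d \<and> E d e \<and> E e a \<and>
     \<not> E a c \<and> \<not> E b d \<and> \<not> E c e \<and> \<not> E d a \<and> \<not> E e b"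

definition induced_C6 :: "('a \<Rightarrow> 'a \<Rightarrow> bool) \<Rightarrow> 'a \<Rightarrow> 'a \<Rightarrow> 'a \<Rightarrow> 'a \<Rightarrow> 'a \<Rightarrow> 'a \<Rightarrow> bool" where
  "induced_C6 E a b c d e f \<longleftrightarrow> E a b \<and> E b c \<and> E c d \<and> E d e \<and> E e f \<and> E f a \<and>
     \<not> E a c \<and> \<not> E b d \<and> \<not> E c e \<and> \<not> E d f \<and> \<not> E e a \<and> \<not> E f b \<and> \<not> E a d \<and> \<not> E b e \<and> \<not> E c f"

definition induced_co_C6 :: "('a \<Rightarrow> 'a \<Rightarrow> bool) \<Rightarrow> 'a \<Rightarrow> 'a \<Rightarrow> 'a \<Rightarrow> 'a \<Rightarrow> 'a \<Rightarrow> 'a \<Rightarrow> bool" where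
  "induced_co_C6 E a b c d e f \<longleftrightarrow> \<not> E a b \<and> \<not> E b c \<and> \<not> E c d \<and> \<not> E d e \<and> \<not> E e f \<and> \<not> E f a \<and>
     E a c \<and> E b d \<and> E c e \<and> E d f \<and> E e a \<and> E f b \<and> E a d \<and> E b e \<and> E c f"

lemmas induced_defs =
  induced_C4_def induced_2K2_def induced_C5_def induced_C6_def induced_co_C6_def

definition compl_adj :: "'a set \<Rightarrow> ('a \<Rightarrow> 'a \<Rightarrow> bool) \<Rightarrow> 'a \<Rightarrow> 'a \<Rightarrow> bool" where
  "compl_adj V E u v \<longleftrightarrow> u \<in> V \<and> v \<in> V \<and> u \<noteq> v \<and> \<not> E u v"

definition stable_in :: "('a \<Rightarrow> 'a \<Rightarrow> bool) \<Rightarrow> 'a set \<Rightarrow> bool" where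
  "stable_in E S \<longleftrightarrow> (\<forall>u\<in>S. \<forall>v\<in>S. \<not> E u v)"

definition degree_in :: "('a \<Rightarrow> 'a \<Rightarrow> bool) \<Rightarrow> 'a set \<Rightarrow> 'a \<Rightarrow> nat" where
  "degree_in E S v = card {u \<in> S. E v u}"

locale sgraph =
  fixes V :: "'a set" and E :: "'a \<Rightarrow> 'a \<Rightarrow> bool"
  assumes finite_V: "finite V"
    and sym: "E u v \<Longrightarrow> E v u"
    and irrefl: "\<not> E u u"
    and in_V: "E u v \<Longrightarrow> u \<in> V"
begin

lemma adj_commute: "E u v \<longleftrightarrow> E v u"
  using sym by blast

lemma in_V2: "E u v \<Longrightarrow> v \<in> V"
  using sym in_V by blast

lemma distinct_C4: "induced_C4 E a b c d \<Longrightarrow> distinct [a, b, c, d]"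
  and distinct_C5: "induced_C5 E a b c d e \<Longrightarrow> distinct [a, b, c, d, e]"
  and distinct_C6: "induced_C6 E a b c d e f \<Longrightarrow> distinct [a, b, c, d, e, f]"
  and distinct_co_C6: "induced_co_C6 E a b c d e f \<Longrightarrow> distinct [a, b, c, d, e, f]"
  using sym irrefl unfolding induced_defs by (simp, metis)+

lemma C4_subset: "induced_C4 E a b c d \<Longrightarrow> {a, b, c, d} \<subseteq> V"
  and two_K2_subset: "induced_2K2 E p q r s \<Longrightarrow> {p, q, r, s} \<subseteq> V"
  and C5_subset: "induced_C5 E a b c d e \<Longrightarrow> {a, b, c, d, e} \<subseteq> V"
  and C6_subset: "induced_C6 E a b c d e f \<Longrightarrow> {a, b, c, d, e, f} \<subseteq> V"
  and co_C6_subset: "induced_co_C6 E a b c d e f \<Longrightarrow> {a, b, c, d, e, f} \<subseteq> V"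
  using in_V in_V2 unfolding induced_defs by blast+

lemma C4_rotate: "induced_C4 E a b c d \<Longrightarrow> induced_C4 E b c d a"
  and C4_reflect: "induced_C4 E a b c d \<Longrightarrow> induced_C4 E b a d c"
  and two_K2_swap: "induced_2K2 E p q r s \<Longrightarrow> induced_2K2 E r s p q"
  and two_K2_flip: "induced_2K2 E p q r s \<Longrightarrow> induced_2K2 E q p r s"
  using sym unfolding induced_defs by metis+

lemma C6_imp_2K2: "induced_C6 E a b c d e f \<Longrightarrow> induced_2K2 E a b d e"
  and co_C6_imp_C4: "induced_co_C6 E a b c d e f \<Longrightarrow> induced_C4 E a d b e"
  using sym irrefl unfolding induced_defs by metis+

subsection \<open>Complementation\<close>

lemma compl_adj_compl_adj: "compl_adj V (compl_adj V E) = E"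
  using in_V sym irrefl by (fastforce simp: compl_adj_def fun_eq_iff)

lemma sgraph_compl_adj: "sgraph V (compl_adj V E)"
  using finite_V sym by unfold_locales (auto simp: compl_adj_def)

lemma C4_of_compl_2K2: "induced_2K2 (compl_adj V E) p q r s \<Longrightarrow> induced_C4 E p r q s"
  and two_K2_of_compl_C4: "induced_C4 (compl_adj V E) p r q s \<Longrightarrow> induced_2K2 E p q r s"
  and C5_of_compl_C5: "induced_C5 (compl_adj V E) a b c d e \<Longrightarrow> induced_C5 E a c e b d"
  and co_C6_of_compl_C6: "induced_C6 (compl_adj V E) a b c d e f \<Longrightarrow> induced_co_C6 E a b c d e f"
  and C6_of_compl_co_C6: "induced_co_C6 (compl_adj V E) a b c d e f \<Longrightarrow> induced_C6 E a b c d e f"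
  using sym unfolding induced_defs compl_adj_def by metis+

lemma compl_2K2_of_C4: "induced_C4 E p r q s \<Longrightarrow> induced_2K2 (compl_adj V E) p q r s"
  and compl_C4_of_2K2: "induced_2K2 E p q r s \<Longrightarrow> induced_C4 (compl_adj V E) p r q s"
  and compl_C5_of_C5: "induced_C5 E a b c d e \<Longrightarrow> induced_C5 (compl_adj V E) a c e b d"
  and compl_co_C6_of_C6: "induced_C6 E a b c d e f \<Longrightarrow> induced_co_C6 (compl_adj V E) a b c d e f"
  and compl_C6_of_co_C6: "induced_co_C6 E a b c d e f \<Longrightarrow> induced_C6 (compl_adj V E) a b c d e f"
  by (rule sgraph.two_K2_of_compl_C4[OF sgraph_compl_adj, unfolded compl_adj_compl_adj]
      sgraph.C4_of_compl_2K2[OF sgraph_compl_adj, unfolded compl_adj_compl_adj]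
      sgraph.C5_of_compl_C5[OF sgraph_compl_adj, unfolded compl_adj_compl_adj]
      sgraph.C6_of_compl_co_C6[OF sgraph_compl_adj, unfolded compl_adj_compl_adj]
      sgraph.co_C6_of_compl_C6[OF sgraph_compl_adj, unfolded compl_adj_compl_adj]; assumption)+

end

section \<open>The rules excluding small wheels and antiwheels\<close>

text \<open>
  In the rules for 4-holes and \<open>2K\<^sub>2\<close> all distinctness conditions on \<open>v\<close> other than \<open>v \<noteq> r\<close> follow
  from the adjacencies, and three vertices of the pattern can always be labelled as assumed.
\<close>

locale C4_wheel_free = sgraph +
  assumes C4_rule: "\<lbrakk>induced_C4 E a b c d; E v a; E v b; E v c\<rbrakk> \<Longrightarrow> False"

locale small_wheel_rules = C4_wheel_free +
  assumes two_K2_rule: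
      "\<lbrakk>induced_2K2 E p q r s; v \<in> V; v \<noteq> r; \<not> E v p; \<not> E v q; \<not> E v r\<rbrakk> \<Longrightarrow> False"
    and C5_spans: "induced_C5 E a b c d e \<Longrightarrow> V = {a, b, c, d, e}"
    and C6_spans: "induced_C6 E a b c d e f \<Longrightarrow> V = {a, b, c, d, e, f}"
    and co_C6_spans: "induced_co_C6 E a b c d e f \<Longrightarrow> V = {a, b, c, d, e, f}"

lemma (in C4_wheel_free) compl_two_K2_rule:
  assumes two_K2: "induced_2K2 (compl_adj V E) p q r s" and v: "v \<in> V" "v \<noteq> r"
    and non_adj: "\<not> compl_adj V E v p" "\<not> compl_adj V E v q" "\<not> compl_adj V E v r"
  shows False
proof -
  have "{p, q, r, s} \<subseteq> V"
    by (rule sgraph.two_K2_subset[OF sgraph_compl_adj two_K2])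
  moreover have "v \<noteq> p" "v \<noteq> q"
    using two_K2 non_adj(1-2) sym unfolding induced_2K2_def compl_adj_def by blast+
  ultimately have "E v p" "E v r" "E v q"
    using v non_adj unfolding compl_adj_def by blast+
  then show False
    using C4_rule[OF C4_of_compl_2K2[OF two_K2]] by blast
qed

lemma (in small_wheel_rules) small_wheel_rules_compl_adj: "small_wheel_rules V (compl_adj V E)"
proof -
  interpret compl: sgraph V "compl_adj V E" by (rule sgraph_compl_adj)
  show ?thesis
  proof
    fix a b c d v
    assume "induced_C4 (compl_adj V E) a b c d"
      and adj: "compl_adj V E v a" "compl_adj V E v b" "compl_adj V E v c"
    from two_K2_rule[OF two_K2_of_compl_C4[OF this(1)], of v] adj show False
      unfolding compl_adj_def by blast
  next
    fix p q r s v
    assume "induced_2K2 (compl_adj V E) p q r s" "v \<in> V" "v \<noteq> r"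
      "\<not> compl_adj V E v p" "\<not> compl_adj V E v q" "\<not> compl_adj V E v r"
    then show False by (rule compl_two_K2_rule)
  next
    fix a b c d e assume "induced_C5 (compl_adj V E) a b c d e"
    from C5_spans[OF C5_of_compl_C5[OF this]] show "V = {a, b, c, d, e}" by auto
  next
    fix a b c d e f assume "induced_C6 (compl_adj V E) a b c d e f"
    from co_C6_spans[OF co_C6_of_compl_C6[OF this]] show "V = {a, b, c, d, e, f}" .
  next
    fix a b c d e f assume "induced_co_C6 (compl_adj V E) a b c d e f"
    from C6_spans[OF C6_of_compl_co_C6[OF this]] show "V = {a, b, c, d, e, f}" .
  qed
qed

section \<open>The classes as partitions\<close>

locale class_A_partition = sgraph +
  fixes a b c d e :: 'a and X :: "'a set"
  assumes distinct: "distinct [a, b, c, d, e]"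
    and V_eq: "V = {a, b, c, d, e} \<union> X"
    and disjoint: "{a, b, c, d, e} \<inter> X = {}"
    and hole: "induced_C4 E a b c d"
    and X_nonempty: "X \<noteq> {}"
    and X_clique: "pairwise E X"
    and X_complete: "s \<in> X \<Longrightarrow> E s c \<and> E s d"
    and X_anticomplete: "s \<in> X \<Longrightarrow> \<not> E s a \<and> \<not> E s b"
    and e_complete: "s \<in> X \<Longrightarrow> E e s"
    and e_anticomplete: "\<not> E e a" "\<not> E e b"
    and e_not_both: "\<not> (E e c \<and> E e d)"

text \<open>
  As \<open>x\<close> is complete to \<open>Y\<close> and \<open>y\<close> to \<open>X\<close>, connectedness is automatic, and \<open>P\<^sub>5\<close>-freeness of
  \<open>X \<union> Y\<close> amounts to the absence of an induced \<open>2K\<^sub>2\<close>.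
\<close>

locale class_B_partition = sgraph +
  fixes X Y Z W :: "'a set" and x y :: 'a
  assumes V_eq: "V = X \<union> Y \<union> Z \<union> W"
    and disjoint: "X \<inter> Y = {}" "X \<inter> Z = {}" "X \<inter> W = {}" "Y \<inter> Z = {}" "Y \<inter> W = {}" "Z \<inter> W = {}"
    and stable_parts: "stable_in E X" "stable_in E Y" "stable_in E Z"
    and W_isolated: "\<lbrakk>w \<in> W; v \<in> V\<rbrakk> \<Longrightarrow> \<not> E w v"
    and x_in: "x \<in> X" and y_in: "y \<in> Y"
    and not_singleton: "X \<noteq> {x}" "Y \<noteq> {y}"
    and no_2K2_across: "\<lbrakk>p \<in> X; r \<in> X; q \<in> Y; s \<in> Y\<rbrakk> \<Longrightarrow> \<not> induced_2K2 E p q r s"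
    and x_complete: "v \<in> Y \<Longrightarrow> E x v" and y_complete: "u \<in> X \<Longrightarrow> E y u"
    and Z_complete: "z \<in> Z \<Longrightarrow> E z x \<and> E z y"
    and Z_anticomplete: "\<lbrakk>z \<in> Z; v \<in> X \<union> Y - {x, y}\<rbrakk> \<Longrightarrow> \<not> E z v"

locale class_C_partition = sgraph +
  fixes X Y :: "'a set" and x1 x2 y1 y2 :: 'a
  assumes V_eq: "V = X \<union> Y" and disjoint: "X \<inter> Y = {}"
    and cliques: "pairwise E X" "pairwise E Y"
    and ends: "x1 \<in> X" "x2 \<in> X" "x1 \<noteq> x2" "y1 \<in> Y" "y2 \<in> Y" "y1 \<noteq> y2"
    and across_iff:
      "\<lbrakk>s \<in> X; t \<in> Y\<rbrakk> \<Longrightarrow> E s t \<longleftrightarrow> s = x1 \<and> t = y1 \<or> s = x2 \<and> t = y2"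

definition adj_class_A :: "'a set \<Rightarrow> ('a \<Rightarrow> 'a \<Rightarrow> bool) \<Rightarrow> bool" where
  "adj_class_A V E \<longleftrightarrow> (\<exists>a b c d e X. class_A_partition V E a b c d e X)"

definition adj_class_B :: "'a set \<Rightarrow> ('a \<Rightarrow> 'a \<Rightarrow> bool) \<Rightarrow> bool" where
  "adj_class_B V E \<longleftrightarrow> (\<exists>X Y Z W x y. class_B_partition V E X Y Z W x y)"

definition adj_class_C :: "'a set \<Rightarrow> ('a \<Rightarrow> 'a \<Rightarrow> bool) \<Rightarrow> bool" where
  "adj_class_C V E \<longleftrightarrow> (\<exists>X Y x1 x2 y1 y2. class_C_partition V E X Y x1 x2 y1 y2)"

section \<open>Graphs with a 4-hole and an induced 2K2\<close>

locale exceptional_hole_free = small_wheel_rules +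
  assumes no_C5: "\<not> induced_C5 E a b c d e"
    and no_C6: "\<not> induced_C6 E a b c d e f"
    and no_co_C6: "\<not> induced_co_C6 E a b c d e f"

lemma (in exceptional_hole_free) exceptional_hole_free_compl_adj:
  "exceptional_hole_free V (compl_adj V E)"
proof -
  interpret compl: small_wheel_rules V "compl_adj V E" by (rule small_wheel_rules_compl_adj)
  show ?thesis
    using C5_of_compl_C5 co_C6_of_compl_C6 C6_of_compl_co_C6 no_C5 no_C6 no_co_C6
    by unfold_locales metis+
qed

definition edge_sharing :: "('a \<Rightarrow> 'a \<Rightarrow> bool) \<Rightarrow> 'a \<Rightarrow> 'a \<Rightarrow> 'a \<Rightarrow> 'a \<Rightarrow> 'a \<Rightarrow> 'a \<Rightarrow> bool" where
  "edge_sharing E a b c d u v \<longleftrightarrow> induced_C4 E a b c d \<and> induced_2K2 E a b u v"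

definition nonedge_sharing :: "('a \<Rightarrow> 'a \<Rightarrow> bool) \<Rightarrow> 'a \<Rightarrow> 'a \<Rightarrow> 'a \<Rightarrow> 'a \<Rightarrow> 'a \<Rightarrow> 'a \<Rightarrow> bool" where
  "nonedge_sharing E a b c d u v \<longleftrightarrow> induced_C4 E a b c d \<and> induced_2K2 E a u c v"

definition pair_sharing :: "('a \<Rightarrow> 'a \<Rightarrow> bool) \<Rightarrow> bool" where
  "pair_sharing E \<longleftrightarrow>
     (\<exists>a b c d u v. edge_sharing E a b c d u v \<or> nonedge_sharing E a b c d u v)"

definition class_A_sharing :: "('a \<Rightarrow> 'a \<Rightarrow> bool) \<Rightarrow> 'a \<Rightarrow> 'a \<Rightarrow> 'a \<Rightarrow> 'a \<Rightarrow> 'a \<Rightarrow> 'a \<Rightarrow> bool" where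
  "class_A_sharing E a b c d u v \<longleftrightarrow>
     edge_sharing E a b c d u v \<and> E u c \<and> E u d \<and> \<not> (E v c \<and> E v d)"

definition domino_sharing :: "('a \<Rightarrow> 'a \<Rightarrow> bool) \<Rightarrow> 'a \<Rightarrow> 'a \<Rightarrow> 'a \<Rightarrow> 'a \<Rightarrow> 'a \<Rightarrow> 'a \<Rightarrow> bool" where
  "domino_sharing E a b c d u v \<longleftrightarrow>
     edge_sharing E a b c d u v \<and> E u c \<and> E v d \<and> \<not> E u d \<and> \<not> E v c"

lemmas sharing_defs = edge_sharing_def nonedge_sharing_def induced_C4_def induced_2K2_def

lemma (in sgraph) nonedge_sharing_imp_compl_edge_sharing:
  "nonedge_sharing E a b c d u v \<Longrightarrow> edge_sharing (compl_adj V E) a c u v b d"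
  using compl_C4_of_2K2 compl_2K2_of_C4 unfolding sharing_defs(1,2) by blast

lemma (in sgraph) edge_sharing_flip:
    "edge_sharing E a b c d u v \<Longrightarrow> edge_sharing E a b c d v u"
  and class_A_sharing_reflect:
    "class_A_sharing E a b c d u v \<Longrightarrow> class_A_sharing E b a d c u v"
  and domino_sharing_reflect:
    "domino_sharing E a b c d u v \<Longrightarrow> domino_sharing E b a d c v u"
  and domino_sharing_swap:
    "domino_sharing E a b c d u v \<Longrightarrow> domino_sharing E v u c d b a"
  using sym irrefl unfolding class_A_sharing_def domino_sharing_def sharing_defs by metis+

context exceptional_hole_free
begin

subsection \<open>A shared pair of vertices\<close>

lemma pair_sharing_of_common_vertex:
  assumes C4: "induced_C4 E a b c d" and two_K2: "induced_2K2 E a q r s"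
  shows "pair_sharing E"
proof (rule ccontr)
  assume neg: "\<not> ?thesis"
  have "E q c"
  proof (rule ccontr)
    assume "\<not> E q c"
    have "\<not> nonedge_sharing E a b c d q r" "\<not> nonedge_sharing E a b c d q s"
      using neg unfolding pair_sharing_def by blast+
    then have "\<not> E c r" "\<not> E c s" "c \<noteq> r" "c \<noteq> s"
      using C4 two_K2 \<open>\<not> E q c\<close> sym unfolding sharing_defs by blast+
    then show False
      using two_K2_rule[OF two_K2, of c] C4 two_K2 C4_subset[OF C4] \<open>\<not> E q c\<close> sym
      unfolding induced_C4_def by blast
  qed
  moreover have "q \<noteq> b"
    using neg C4 two_K2 unfolding pair_sharing_def edge_sharing_def by blast
  moreover have "\<not> E q b"
    using C4_rule[OF C4, of q] \<open>E q c\<close> two_K2 sym unfolding induced_2K2_def by blast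
  ultimately have "induced_C4 E a q c b"
    using C4 two_K2 sym unfolding sharing_defs by blast
  then have "edge_sharing E a q c b r s"
    using two_K2 unfolding edge_sharing_def by blast
  then show False
    using neg unfolding pair_sharing_def by blast
qed

lemma pair_sharing_if_not_disjoint:
  assumes C4: "induced_C4 E a b c d" and two_K2: "induced_2K2 E p q r s"
    and meet: "{a, b, c, d} \<inter> {p, q, r, s} \<noteq> {}"
  shows "pair_sharing E"
proof -
  obtain x where "x \<in> {a, b, c, d}" "x \<in> {p, q, r, s}" using meet by blast
  moreover have "induced_C4 E b c d a" "induced_C4 E c d a b" "induced_C4 E d a b c"
    using C4 C4_rotate by blast+
  ultimately obtain b' c' d' where "induced_C4 E x b' c' d'"
    using C4 by blast
  moreover have "induced_2K2 E q p r s" "induced_2K2 E r s p q" "induced_2K2 E s r p q"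
    using two_K2 two_K2_swap two_K2_flip by blast+
  then obtain q' r' s' where "induced_2K2 E x q' r' s'"
    using \<open>x \<in> {p, q, r, s}\<close> two_K2 by blast
  ultimately show ?thesis
    by (rule pair_sharing_of_common_vertex)
qed

lemma C4_vertex_adj_to_2K2_edge:
  assumes neg: "\<not> pair_sharing E"
    and C4: "induced_C4 E a b c d" and two_K2: "induced_2K2 E p q r s" and x: "x \<in> {a, b, c, d}"
  shows "E x p \<or> E x q"
proof (rule ccontr)
  assume "\<not> ?thesis"
  moreover from this have "E x r"
    using two_K2_rule[OF two_K2, of x] pair_sharing_if_not_disjoint[OF C4 two_K2] neg x
      C4_subset[OF C4]
    by blast
  ultimately have "induced_2K2 E x r p q"
    using two_K2 sym unfolding induced_2K2_def by blast
  then show False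
    using pair_sharing_if_not_disjoint[OF C4] neg x by blast
qed

lemma two_K2_vertex_not_adj_to_opposite:
  assumes neg: "\<not> pair_sharing E"
    and C4: "induced_C4 E a b c d" and two_K2: "induced_2K2 E p q r s" and x: "x \<in> {p, q, r, s}"
  shows "\<not> (E x a \<and> E x c)"
proof
  assume adj: "E x a \<and> E x c"
  then have "\<not> E x b" using C4_rule[OF C4] by blast
  moreover have "x \<noteq> b"
    using pair_sharing_if_not_disjoint[OF C4 two_K2] neg x by blast
  ultimately have "induced_C4 E a b c x"
    using adj C4 sym unfolding induced_C4_def by blast
  then show False
    using pair_sharing_if_not_disjoint[OF _ two_K2] neg x by blast
qed

text \<open>
  Without a shared pair every vertex of the 4-hole has a neighbour among \<open>p, q\<close>, while neither
  \<open>p\<close> nor \<open>q\<close> is adjacent to two opposite ones; so some edge of the 4-hole spans a 4-hole with \<open>pq\<close>.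
\<close>

lemma pair_sharing_if_C4_2K2:
  assumes C4: "induced_C4 E a b c d" and two_K2: "induced_2K2 E p q r s"
  shows "pair_sharing E"
proof (rule ccontr)
  assume neg: "\<not> ?thesis"
  note disjoint = pair_sharing_if_not_disjoint[THEN notE[OF neg]]
  note neighbour = C4_vertex_adj_to_2K2_edge[OF neg C4 two_K2]
  have no_opposite: "\<not> (E x a \<and> E x c)" "\<not> (E x b \<and> E x d)" if "x \<in> {p, q}" for x
    using two_K2_vertex_not_adj_to_opposite[OF neg _ two_K2] C4 C4_rotate[OF C4] that by blast+
  have no_C4: "\<not> induced_C4 E x y z w" if "x \<in> {p, q}" for x y z w
    using disjoint[OF _ two_K2] that by blast
  have False if x: "x \<in> {p, q}" "E x a" and y: "y \<in> {p, q}" "E x y" for x y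
  proof -
    have nbr: "E x z \<or> E y z" if "z \<in> {a, b, c, d}" for z
      using neighbour[OF that] x(1) y irrefl sym by blast
    have xy: "x \<noteq> z" "y \<noteq> z" if "z \<in> {a, b, c, d}" for z
      using disjoint[OF C4 two_K2] x(1) y(1) that by blast+
    have "\<not> E x c" "E y c" "\<not> E y a"
      using nbr[of c] no_opposite(1)[OF x(1)] no_opposite(1)[OF y(1)] x(2) by blast+
    show False
    proof (cases "E x b")
      case True
      then have "\<not> E y b"
        using nbr[of d] no_opposite(2)[OF x(1)] no_opposite(2)[OF y(1)] by blast
      then have "induced_C4 E x y c b"
        using True \<open>\<not> E x c\<close> \<open>E y c\<close> y(2) C4 xy sym unfolding induced_C4_def by blast
      then show False using no_C4[OF x(1)] by blast
    next
      case False
      then have "induced_C4 E x y b a"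
        using nbr[of b] \<open>\<not> E y a\<close> x(2) y(2) C4 xy sym unfolding induced_C4_def by blast
      then show False using no_C4[OF x(1)] by blast
    qed
  qed
  then show False
    using neighbour[of a] two_K2 sym unfolding induced_2K2_def by blast
qed

subsection \<open>A shared edge\<close>

lemma not_adj_if_adj_opposite_edge:
  assumes C4: "induced_C4 E a b c d" and u: "E u c" "E u d" "\<not> E u a" "\<not> E u b"
    and t: "E t a" "t \<noteq> d"
  shows "\<not> E t u"
proof
  assume "E t u"
  have "t \<noteq> c" "t \<noteq> b"
    using C4 t \<open>E t u\<close> u
    by (auto simp: induced_C4_def adj_commute)
  show False
  proof (cases "E t b")
    case True
    then have "\<not> E t c" "\<not> E t d"
      using t C4_rule[OF C4] C4_rule[OF C4_reflect[OF C4]] by blast+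
    then have "induced_co_C6 E a c t d b u"
      using True C4 u t \<open>E t u\<close>
      by (auto simp: induced_defs adj_commute)
    then show False using no_co_C6 by blast
  next
    case False
    have "E t c"
      using no_C5[of a b c u t] False C4 u t \<open>E t u\<close>
      by (auto simp: induced_defs adj_commute)
    then have "induced_C4 E a t c d"
      using C4_rule[OF C4_rotate[OF C4_rotate[OF C4]], of t] C4 t
      by (auto simp: induced_C4_def adj_commute)
    from C4_rule[OF C4_rotate[OF this], of u] show False
      using u \<open>E t u\<close> sym by blast
  qed
qed

lemma edge_sharing_vertices:
  assumes "edge_sharing E a b c d u v"
  shows "{a, b, c, d, u, v} \<subseteq> V" "distinct [a, b, c, d, u, v]"
proof -
  show "{a, b, c, d, u, v} \<subseteq> V"
    using assms C4_subset two_K2_subset unfolding edge_sharing_def by blast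
  show "distinct [a, b, c, d, u, v]"
    using assms sym irrefl unfolding sharing_defs by (simp, metis)
qed

lemma class_A_sharingD:
  assumes "class_A_sharing E a b c d u v"
  shows "induced_C4 E a b c d" "induced_2K2 E a b u v" "E u c" "E u d" "\<not> (E v c \<and> E v d)"
    "{a, b, c, d, u, v} \<subseteq> V" "distinct [a, b, c, d, u, v]"
proof -
  have sharing: "edge_sharing E a b c d u v" using assms unfolding class_A_sharing_def by blast
  then show "{a, b, c, d, u, v} \<subseteq> V" "distinct [a, b, c, d, u, v]"
    by (rule edge_sharing_vertices)+
qed (use assms in \<open>auto simp: class_A_sharing_def edge_sharing_def\<close>)

lemma class_A_sharing_not_adj_both:
  assumes sharing: "class_A_sharing E a b c d u v" and t: "t \<in> V - {a, b, c, d, u, v}"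
  shows "\<not> (E t a \<and> E t b)"
proof
  assume adj_ab: "E t a \<and> E t b"
  note config = class_A_sharingD[OF sharing]
  note C4 = config(1) and v = config(5)
  have not_u: "\<not> E t u"
    using not_adj_if_adj_opposite_edge[OF C4 config(3,4), of t] adj_ab config(2) t
    by (auto simp: induced_2K2_def adj_commute)
  have not_cd: "\<not> E t c" "\<not> E t d"
    using adj_ab C4_rule[OF C4] C4_rule[OF C4_reflect[OF C4]] by blast+
  have "E v t"
  proof (cases "E v d")
    case True
    then show ?thesis
      using adj_ab not_u not_cd config t two_K2_rule[of t a c u v]
      by (auto simp: induced_defs adj_commute)
  next
    case False
    then show ?thesis
      using adj_ab not_u not_cd config t two_K2_rule[of t b d u v]
      by (auto simp: induced_defs adj_commute)
  qed
  then show False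
    using adj_ab not_u not_cd config no_C5[of t v u d a] no_C5[of t v u c b]
    by (simp add: induced_defs adj_commute)
qed

lemma class_A_sharing_not_adj:
  assumes sharing: "class_A_sharing E a b c d u v" and t: "t \<in> V - {a, b, c, d, u, v}"
  shows "\<not> E t a"
proof
  assume adj_a: "E t a"
  note config = class_A_sharingD[OF sharing]
  note C4 = config(1)
  have not_b: "\<not> E t b"
    using class_A_sharing_not_adj_both[OF sharing t] adj_a by blast
  have not_u: "\<not> E t u"
    using not_adj_if_adj_opposite_edge[OF C4 config(3,4) _ _ adj_a] config(2) t
    by (auto simp: induced_2K2_def adj_commute)
  have adj_v: "E t v"
    using two_K2_rule[of u v b a t] not_u not_b t config(2)
    by (auto simp: induced_2K2_def adj_commute)
  note attached = adj_a not_b not_u adj_v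
  show False
  proof (cases "E t c")
    case True
    then have not_d: "\<not> E t d"
      using adj_a C4_rule[OF C4_rotate[OF C4_rotate[OF C4]], of t] by blast
    then have "E v d"
      using no_C5[of a t v u d] attached config by (auto simp: induced_defs adj_commute)
    then have "induced_C4 E t v d c"
      using config(5) True not_d attached C4 t config(7) by (auto simp: induced_defs adj_commute)
    from C4_rule[OF C4_rotate[OF this], of u] show False
      using config unfolding induced_2K2_def by blast
  next
    case False
    then show False
      using attached config no_C5[of a b c v t] no_C6[of a b c u v t]
      by (auto simp: induced_defs adj_commute)
  qed
qed

lemma class_A_sharing_adj_opposite:
  assumes sharing: "class_A_sharing E a b c d u v" and t: "t \<in> V - {a, b, c, d, u, v}"
  shows "E t c"
proof (rule ccontr)
  assume not_c: "\<not> E t c"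
  note config = class_A_sharingD[OF sharing]
  have not_ab: "\<not> E t a" "\<not> E t b"
    using class_A_sharing_not_adj[OF sharing t]
      class_A_sharing_not_adj[OF class_A_sharing_reflect[OF sharing], of t] t by blast+
  then have adj_uv: "E t u" "E t v"
    using two_K2_rule[of a b u v t] two_K2_rule[of a b v u t] config(2) t
    by (auto simp: induced_2K2_def adj_commute)
  note attached = not_c not_ab adj_uv t
  have "E v c"
    using attached config two_K2_rule[of t v c b a] by (auto simp: induced_defs adj_commute)
  then have not_vd: "\<not> E v d" using config(5) by blast
  then have "E t d"
    using attached config two_K2_rule[of t v d a b] by (auto simp: induced_defs adj_commute)
  then have "induced_C4 E d t v c"
    using attached config \<open>E v c\<close> not_vd by (auto simp: induced_defs adj_commute)
  then show False
    using C4_rule[of d t v c u] adj_uv(1) config(2,4) sym unfolding induced_2K2_def by blast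
qed

lemma class_A_sharing_attachment:
  assumes sharing: "class_A_sharing E a b c d u v" and s: "s \<in> V - {a, b, c, d, v}"
  shows "E s c" "E s d" "\<not> E s a" "\<not> E s b"
proof -
  have "E s c \<and> E s d \<and> \<not> E s a \<and> \<not> E s b"
  proof (cases "s = u")
    case True
    then show ?thesis
      using class_A_sharingD[OF sharing] by (simp add: induced_2K2_def adj_commute)
  next
    case False
    then have "s \<in> V - {a, b, c, d, u, v}" "s \<in> V - {b, a, d, c, u, v}" using s by blast+
    then show ?thesis
      using sharing class_A_sharing_reflect[OF sharing]
      by (blast dest: class_A_sharing_not_adj class_A_sharing_adj_opposite)
  qed
  then show "E s c" "E s d" "\<not> E s a" "\<not> E s b" by blast+
qed

lemma class_A_partition_if_sharing:
  assumes sharing: "class_A_sharing E a b c d u v"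
  shows "class_A_partition V E a b c d v (V - {a, b, c, d, v})"
    (is "class_A_partition V E a b c d v ?X")
proof -
  note config = class_A_sharingD[OF sharing]
  note attach = class_A_sharing_attachment[OF sharing]
  have adj_u: "E s u" and adj_v: "E v s" if "s \<in> ?X" "s \<noteq> u" for s
    using two_K2_rule[of a b u v s] two_K2_rule[of a b v u s] attach[OF that(1)] that config(2)
    by (auto simp: induced_2K2_def adj_commute)
  show ?thesis
  proof
    show "pairwise E ?X"
    proof (rule pairwiseI)
      fix s t assume st: "s \<in> ?X" "t \<in> ?X" "s \<noteq> t"
      show "E s t"
      proof (cases "t = u")
        case True
        then show ?thesis using adj_u st by blast
      next
        case False
        then have "induced_2K2 E a b t u"
          using attach[OF st(2)] adj_u[OF st(2)] config(2)
          by (auto simp: induced_2K2_def adj_commute)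
        then show ?thesis
          using two_K2_rule[of a b t u s] attach[OF st(1)] st by blast
      qed
    qed
    show "E v s" if "s \<in> ?X" for s
      using adj_v[OF that] config(2) by (auto simp: induced_2K2_def adj_commute)
  qed (use attach config sym in \<open>auto simp: induced_2K2_def\<close>)
qed

lemma class_C_sharing_dichotomy:
  assumes sharing: "edge_sharing E a b c d u v" and u: "E u c" "E u d" and v: "E v c" "E v d"
    and no_A: "\<nexists>a b c d u v. class_A_sharing E a b c d u v"
    and t: "t \<in> V - {a, b, c, d, u, v}"
  shows "E t a \<and> E t b \<and> \<not> E t c \<and> \<not> E t d \<and> \<not> E t u \<and> \<not> E t v \<or>
    \<not> E t a \<and> \<not> E t b \<and> E t c \<and> E t d \<and> E t u \<and> E t v"
proof -
  have C4: "induced_C4 E a b c d" and two_K2: "induced_2K2 E a b u v"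
    using sharing unfolding edge_sharing_def by blast+
  show ?thesis
  proof (cases "E t a \<or> E t b")
    case True
    then have "\<not> E t u" "\<not> E t v"
      using not_adj_if_adj_opposite_edge[OF C4 u, of t] not_adj_if_adj_opposite_edge[OF C4 v, of t]
        not_adj_if_adj_opposite_edge[OF C4_reflect[OF C4] u(2,1), of t]
        not_adj_if_adj_opposite_edge[OF C4_reflect[OF C4] v(2,1), of t] t two_K2
      by (auto simp: induced_2K2_def adj_commute)
    moreover from this have "E t a" "E t b"
      using two_K2_rule[of u v a b t] two_K2_rule[of u v b a t] two_K2 t
      by (auto simp: induced_2K2_def adj_commute)
    moreover from this have "\<not> E t c" "\<not> E t d"
      using C4_rule[OF C4] C4_rule[OF C4_reflect[OF C4]] by blast+
    ultimately show ?thesis by blast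
  next
    case False
    then have "E t u" "E t v"
      using two_K2_rule[of a b u v t] two_K2_rule[of a b v u t] two_K2 t
      by (auto simp: induced_2K2_def adj_commute)
    moreover from this have "edge_sharing E a b c d u t"
      using C4 two_K2 False sym unfolding sharing_defs by blast
    then have "E t c" "E t d"
      using no_A u unfolding class_A_sharing_def by blast+
    ultimately show ?thesis using False by blast
  qed
qed

lemma class_C_partition_if_sharing:
  assumes sharing: "edge_sharing E a b c d u v" and u: "E u c" "E u d" and v: "E v c" "E v d"
    and no_A: "\<nexists>a b c d u v. class_A_sharing E a b c d u v"
  shows "class_C_partition V E {t \<in> V. \<not> E t u \<and> t \<noteq> u} {t \<in> V. E t u \<or> t = u} a b d c"
    (is "class_C_partition V E ?X ?Y a b d c")
proof -
  have C4: "induced_C4 E a b c d" and two_K2: "induced_2K2 E a b u v"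
    using sharing unfolding edge_sharing_def by blast+
  note vertices = edge_sharing_vertices[OF sharing]
  note dichotomy = class_C_sharing_dichotomy[OF sharing u v no_A]
  have in_X: "t = a \<or> t = b \<or> E t a \<and> E t b \<and> \<not> E t c \<and> \<not> E t d \<and> \<not> E t v"
    if "t \<in> ?X" for t
    using that dichotomy[of t] u two_K2
    by (cases "t \<in> {a, b, c, d, u, v}") (auto simp: induced_2K2_def adj_commute)
  have in_Y: "t = c \<or> t = d \<or> t = u \<or> t = v \<or>
      E t c \<and> E t d \<and> E t u \<and> \<not> E t a \<and> \<not> E t b" if "t \<in> ?Y" for t
    using that dichotomy[of t] C4 two_K2
    by (cases "t \<in> {a, b, c, d, u, v}") (auto simp: induced_2K2_def adj_commute)
  show ?thesis
  proof
    show "pairwise E ?X"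
    proof (rule pairwiseI)
      fix s t assume st: "s \<in> ?X" "t \<in> ?X" "s \<noteq> t"
      then show "E s t"
        using in_X[OF st(1)] in_X[OF st(2)] two_K2_rule[of u c t a s] u C4 two_K2
        by (auto simp: induced_defs adj_commute)
    qed
    show "pairwise E ?Y"
    proof (rule pairwiseI)
      fix s t assume st: "s \<in> ?Y" "t \<in> ?Y" "s \<noteq> t"
      then show "E s t"
        using in_Y[OF st(1)] in_Y[OF st(2)] two_K2_rule[of a b t u s] u v C4 two_K2
        by (auto simp: induced_defs adj_commute)
    qed
    show "E s t \<longleftrightarrow> s = a \<and> t = d \<or> s = b \<and> t = c" if "s \<in> ?X" "t \<in> ?Y" for s t
      using in_X[OF that(1)] in_Y[OF that(2)] that not_adj_if_adj_opposite_edge[OF C4, of t s]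
        C4 two_K2 vertices
      by (auto simp: induced_defs adj_commute)
  qed (use vertices u v C4 two_K2 sym in \<open>auto simp: induced_defs\<close>)
qed

lemma domino_sharing_not_adj_both:
  assumes domino: "domino_sharing E a b c d u v" and t: "t \<in> V - {a, b, c, d, u, v}"
  shows "\<not> (E t a \<and> E t b)"
proof
  assume tab: "E t a \<and> E t b"
  note defs = domino_sharing_def edge_sharing_def
  have C4: "induced_C4 E a b c d" using domino unfolding defs by blast
  have tcd: "\<not> E t c" "\<not> E t d"
    using tab C4_rule[OF C4] C4_rule[OF C4_reflect[OF C4]] by blast+
  then have "\<not> E t u" "\<not> E t v"
    using no_C5[of a d c u t] no_C5[of b c d v t] tab domino
    by (auto simp: defs induced_defs adj_commute)
  then show False
    using two_K2_rule[of t b d v u] tab tcd domino in_V[of u]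
    by (auto simp: defs induced_defs adj_commute)
qed

lemma domino_sharing_not_adj_across:
  assumes domino: "domino_sharing E a b c d u v" and t: "t \<in> V - {a, b, c, d, u, v}"
  shows "\<not> (E t a \<and> E t u)"
proof
  assume tau: "E t a \<and> E t u"
  note defs = domino_sharing_def edge_sharing_def
  have "\<not> E t b" "\<not> E t v"
    using domino_sharing_not_adj_both[OF domino t]
      domino_sharing_not_adj_both[OF domino_sharing_swap[OF domino], of t] tau t by blast+
  then have "E t c" "E t d"
    using no_C5[of t a b c u] no_C5[of t a d v u] tau domino
    by (auto simp: defs induced_defs adj_commute)
  then show False
    using C4_rule[of c d a b t] tau domino by (auto simp: defs induced_defs adj_commute)
qed

lemma domino_sharing_dichotomy:
  assumes domino: "domino_sharing E a b c d u v" and t: "t \<in> V - {a, b, c, d, u, v}"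
  shows "E t a \<and> E t c \<and> E t v \<and> \<not> E t b \<and> \<not> E t d \<and> \<not> E t u \<or>
    \<not> E t a \<and> \<not> E t c \<and> \<not> E t v \<and> E t b \<and> E t d \<and> E t u"
proof -
  note defs = domino_sharing_def edge_sharing_def
  have attach: "E t c \<and> \<not> E t b \<and> \<not> E t d \<and> \<not> E t u"
    if domino: "domino_sharing E a b c d u v" and t: "t \<in> V - {a, b, c, d, u, v}"
      and tav: "E t a" "E t v" for a b c d u v
  proof -
    have "\<not> E t b" "\<not> E t u"
      using domino_sharing_not_adj_both[OF domino t] domino_sharing_not_adj_across[OF domino t] tav
      by blast+
    moreover from this have "E t c"
      using no_C6[of a b c u v t] tav domino by (auto simp: defs induced_defs adj_commute)
    moreover from this have "\<not> E t d"
      using C4_rule[of c d a b t] tav domino by (auto simp: defs induced_defs adj_commute)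
    ultimately show ?thesis by blast
  qed
  have "t \<in> V - {v, u, c, d, b, a}" "t \<in> V - {b, a, d, c, v, u}" using t by blast+
  note not_both = domino_sharing_not_adj_both[OF domino t]
    domino_sharing_not_adj_both[OF domino_sharing_swap[OF domino] this(1)]
    and across = domino_sharing_not_adj_across[OF domino t]
    domino_sharing_not_adj_across[OF domino_sharing_reflect[OF domino] this(2)]
    and attach' = attach[OF domino_sharing_reflect[OF domino] this(2)]
  have "E t a \<and> E t v \<or> E t b \<and> E t u"
    using not_both across t two_K2_rule[of a b u v t] two_K2_rule[of a b v u t]
      two_K2_rule[of u v a b t] two_K2_rule[of u v b a t] domino
    by (auto simp: defs induced_defs adj_commute)
  then show ?thesis
    using attach[OF domino t] attach' not_both by blast
qed

lemma compl_class_C_partition_if_domino_sharing: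
  assumes domino: "domino_sharing E a b c d u v"
  shows "class_C_partition V (compl_adj V E) {t \<in> V. \<not> E t c} {t \<in> V. E t c} a v u b"
    (is "class_C_partition V _ ?X ?Y a v u b")
proof -
  note defs = domino_sharing_def edge_sharing_def
  note vertices = edge_sharing_vertices[OF conjunct1[OF domino[unfolded domino_sharing_def]]]
  note dichotomy = domino_sharing_dichotomy[OF domino]
  have in_X: "t = a \<or> t = c \<or> t = v \<or> \<not> E t a \<and> \<not> E t c \<and> \<not> E t v \<and> E t b \<and> E t d \<and> E t u"
    if "t \<in> ?X" for t
    using that dichotomy[of t] domino irrefl
    by (cases "t \<in> {a, b, c, d, u, v}") (auto simp: defs induced_defs adj_commute)
  have in_Y: "t = b \<or> t = d \<or> t = u \<or> E t a \<and> E t c \<and> E t v \<and> \<not> E t b \<and> \<not> E t d \<and> \<not> E t u"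
    if "t \<in> ?Y" for t
    using that dichotomy[of t] domino irrefl
    by (cases "t \<in> {a, b, c, d, u, v}") (auto simp: defs induced_defs adj_commute)
  have stable_X: "\<not> E s t" if "s \<in> ?X" "t \<in> ?X" for s t
    using in_X[OF that(1)] in_X[OF that(2)] C4_rule[of b t d a s] domino irrefl
    by (auto simp: defs induced_defs adj_commute)
  have stable_Y: "\<not> E s t" if "s \<in> ?Y" "t \<in> ?Y" for s t
    using in_Y[OF that(1)] in_Y[OF that(2)] C4_rule[of a t c b s] domino irrefl
    by (auto simp: defs induced_defs adj_commute)
  have across: "\<not> E s t \<longleftrightarrow> s = a \<and> t = u \<or> s = v \<and> t = b" if "s \<in> ?X" "t \<in> ?Y" for s t
    using in_X[OF that(1)] in_Y[OF that(2)] no_C6[of a b s u v t] domino vertices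
    by (auto simp: defs induced_defs adj_commute)
  interpret compl: sgraph V "compl_adj V E" by (rule sgraph_compl_adj)
  show ?thesis
  proof
    show "pairwise (compl_adj V E) ?X" "pairwise (compl_adj V E) ?Y"
      using stable_X stable_Y unfolding pairwise_def compl_adj_def by blast+
    show "compl_adj V E s t \<longleftrightarrow> s = a \<and> t = u \<or> s = v \<and> t = b" if "s \<in> ?X" "t \<in> ?Y" for s t
      using across[OF that] that unfolding compl_adj_def by blast
  qed (use vertices domino sym in \<open>auto simp: defs induced_defs\<close>)
qed

lemma adj_class_A_or_C_if_edge_sharing:
  assumes sharing: "edge_sharing E a b c d u v"
  shows "adj_class_A V E \<or> adj_class_C V E \<or> adj_class_C V (compl_adj V E)"
proof (cases "\<exists>a b c d u v. class_A_sharing E a b c d u v")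
  case True
  then show ?thesis
    using class_A_partition_if_sharing unfolding adj_class_A_def by blast
next
  case no_A: False
  note sharing' = edge_sharing_flip[OF sharing]
  have "E u c \<or> E v c" "E u d \<or> E v d"
    using two_K2_rule[of u v a b c] two_K2_rule[of u v b a d] sharing
      edge_sharing_vertices[OF sharing]
    by (auto simp: sharing_defs adj_commute)
  then consider (u) "E u c" "E u d" | (v) "E v c" "E v d"
    | "domino_sharing E a b c d u v" | "domino_sharing E a b c d v u"
    using sharing sharing' unfolding domino_sharing_def by blast
  then show ?thesis
  proof cases
    case u
    then show ?thesis
      using class_C_partition_if_sharing[OF sharing] no_A sharing
      unfolding adj_class_C_def class_A_sharing_def by blast
  next
    case v
    then show ?thesis
      using class_C_partition_if_sharing[OF sharing'] no_A sharing'
      unfolding adj_class_C_def class_A_sharing_def by blast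
  qed (use compl_class_C_partition_if_domino_sharing in \<open>unfold adj_class_C_def, blast+\<close>)
qed

end

section \<open>Graphs without an induced 2K2\<close>

locale two_K2_free = exceptional_hole_free +
  assumes no_2K2: "\<not> induced_2K2 E p q r s"
begin

lemma class_B_partition_of_edge:
  assumes C4: "induced_C4 E a b c d"
    and X: "stable_in E {v \<in> V. E v b \<and> \<not> E v a}" and Y: "stable_in E {v \<in> V. E v a \<and> \<not> E v b}"
    and common: "\<And>z v. \<lbrakk>E z a; E z b; E z v\<rbrakk> \<Longrightarrow> v = a \<or> v = b"
    and neither: "\<And>w v. \<lbrakk>\<not> E w a; \<not> E w b\<rbrakk> \<Longrightarrow> \<not> E w v"
  shows "class_B_partition V E {v \<in> V. E v b \<and> \<not> E v a} {v \<in> V. E v a \<and> \<not> E v b}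
    {v \<in> V. E v a \<and> E v b} {v \<in> V. \<not> E v a \<and> \<not> E v b} a b"
proof
  have abcd: "a \<in> V" "b \<in> V" "c \<in> {v \<in> V. E v b \<and> \<not> E v a}" "d \<in> {v \<in> V. E v a \<and> \<not> E v b}"
      "c \<noteq> a" "d \<noteq> b"
    using C4 C4_subset[OF C4] sym unfolding induced_C4_def by blast+
  then show "{v \<in> V. E v b \<and> \<not> E v a} \<noteq> {a}" "{v \<in> V. E v a \<and> \<not> E v b} \<noteq> {b}" by blast+
  show "a \<in> {v \<in> V. E v b \<and> \<not> E v a}" "b \<in> {v \<in> V. E v a \<and> \<not> E v b}"
    using abcd C4 irrefl sym unfolding induced_C4_def by blast+
  show "stable_in E {v \<in> V. E v a \<and> E v b}"
    using common irrefl unfolding stable_in_def by blast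
qed (use no_2K2 X Y common neither sym in blast)+

subsection \<open>An edge of a 4-hole lying in a triangle\<close>

lemma apex_not_adj_opposite:
  assumes C4: "induced_C4 E a b c d" and u: "E u a" "E u b"
  shows "\<not> E u c" "\<not> E u d"
  using C4_rule[OF C4, of u] C4_rule[OF C4_reflect[OF C4], of u] u by blast+

lemma side_not_adj_opposite:
  assumes C4: "induced_C4 E a b c d" and u: "E u a" "E u b" and p: "E p b" "\<not> E p a"
  shows "\<not> E p c"
proof
  assume "E p c"
  note uc = apex_not_adj_opposite[OF C4 u]
  have "\<not> E p d"
    using C4_rule[OF C4_rotate[OF C4], of p] p \<open>E p c\<close> by blast
  moreover have "E u p"
    using no_2K2[of a u c p] C4 u uc p \<open>E p c\<close> by (simp add: induced_defs adj_commute)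
  ultimately show False
    using no_C5[of a d c p u] C4 u uc p \<open>E p c\<close> by (simp add: induced_defs adj_commute)
qed

lemma side_adj_imp_C4:
  assumes C4: "induced_C4 E a b c d" and p: "E p b" "\<not> E p a" "p \<noteq> a" and "E p d"
  shows "induced_C4 E a b p d"
  using assms by (auto simp: induced_defs adj_commute)

lemma side_stable:
  assumes C4: "induced_C4 E a b c d" and u: "E u a" "E u b"
  shows "stable_in E {v \<in> V. E v b \<and> \<not> E v a}"
  unfolding stable_in_def
proof (intro ballI notI)
  fix p q
  assume pq: "p \<in> {v \<in> V. E v b \<and> \<not> E v a}" "q \<in> {v \<in> V. E v b \<and> \<not> E v a}" "E p q"
  have not_d: "\<not> E p d"
    if p: "E p b" "\<not> E p a" and q: "E q b" "\<not> E q a" and "E p q" for p q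
  proof
    assume "E p d"
    moreover have "p \<noteq> a" using q \<open>E p q\<close> sym by blast
    ultimately have "induced_C4 E a b p d" using side_adj_imp_C4[OF C4 p] by blast
    from side_not_adj_opposite[OF this u q] show False using \<open>E p q\<close> sym by blast
  qed
  have "\<not> E p d" "\<not> E q d"
    using not_d[of p q] not_d[of q p] pq sym by blast+
  then show False
    using no_2K2[of a d p q] C4 pq by (auto simp: induced_defs adj_commute)
qed

lemma apex_not_adj_side:
  assumes C4: "induced_C4 E a b c d" and u: "E u a" "E u b"
    and p: "E p b" "\<not> E p a" "p \<noteq> a"
  shows "\<not> E u p"
proof
  assume "E u p"
  note uc = apex_not_adj_opposite[OF C4 u]
  have "p \<noteq> c" using uc \<open>E u p\<close> by blast
  have "\<not> E p d"
    using C4_rule[OF side_adj_imp_C4[OF C4 p], of u] u \<open>E u p\<close> by blast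
  then show False
    using no_2K2[of c d u p] side_not_adj_opposite[OF C4 u p(1,2)] uc C4 \<open>E u p\<close>
    by (simp add: induced_defs adj_commute)
qed

lemma non_neighbour_not_adj_opposite:
  assumes C4: "induced_C4 E a b c d" and u: "E u a" "E u b" and w: "\<not> E w a" "\<not> E w b"
  shows "\<not> E w c"
proof
  assume "E w c"
  note uc = apex_not_adj_opposite[OF C4 u]
  have "E u w"
    using no_2K2[of a u c w] C4 u uc w \<open>E w c\<close> by (simp add: induced_defs adj_commute)
  moreover from this have "E w d"
    using no_C5[of a d c w u] C4 u uc w \<open>E w c\<close> by (simp add: induced_defs adj_commute)
  ultimately show False
    using no_co_C6[of a c u d b w] C4 u uc w \<open>E w c\<close> by (simp add: induced_defs adj_commute)
qed

lemma non_neighbour_not_adj_side: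
  assumes C4: "induced_C4 E a b c d" and u: "E u a" "E u b" and w: "\<not> E w a" "\<not> E w b"
    and p: "E p b" "\<not> E p a"
  shows "\<not> E w p"
proof
  assume "E w p"
  have "p \<noteq> a" using w \<open>E w p\<close> by blast
  then have "\<not> E p d"
    using non_neighbour_not_adj_opposite[OF side_adj_imp_C4[OF C4 p] u w] \<open>E w p\<close> by blast
  moreover from this have "E w d"
    using no_2K2[of a d p w] C4 w p \<open>E w p\<close> by (simp add: induced_defs adj_commute)
  ultimately show False
    using no_C5[of a b p w d] C4 w p \<open>E w p\<close> by (simp add: induced_defs adj_commute)
qed

lemma apex_neighbours:
  assumes C4: "induced_C4 E a b c d" and u: "E u a" "E u b" and p: "E u p"
  shows "p = a \<or> p = b"
proof (rule ccontr)
  assume neg: "\<not> ?thesis"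
  note C4' = C4_reflect[OF C4] and uc = apex_not_adj_opposite[OF C4 u]
  have "E p a \<longleftrightarrow> E p b"
    using apex_not_adj_side[OF C4 u, of p] apex_not_adj_side[OF C4' u(2,1), of p] p neg by blast
  then have "\<not> E p c" "\<not> E p d"
    using apex_not_adj_opposite[OF C4, of p] non_neighbour_not_adj_opposite[OF C4 u, of p]
      non_neighbour_not_adj_opposite[OF C4' u(2,1), of p] by blast+
  then show False
    using no_2K2[of c d u p] C4 uc p by (simp add: induced_defs adj_commute)
qed

lemma adj_class_B_of_triangle_on_C4:
  assumes C4: "induced_C4 E a b c d" and u: "E u a" "E u b"
  shows "adj_class_B V E"
proof -
  note C4' = C4_reflect[OF C4]
  have "\<not> E w p" if w: "\<not> E w a" "\<not> E w b" for w p
  proof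
    assume "E w p"
    have "E p a \<longleftrightarrow> E p b"
      using non_neighbour_not_adj_side[OF C4 u w] non_neighbour_not_adj_side[OF C4' u(2,1) w(2,1)]
        \<open>E w p\<close> by blast
    moreover have "E p a \<or> E p b"
      using no_2K2[of w p a b] C4 w \<open>E w p\<close> unfolding induced_defs by blast
    ultimately have "w = a \<or> w = b"
      using apex_neighbours[OF C4, of p w] \<open>E w p\<close> sym by blast
    then show False using C4 w sym unfolding induced_C4_def by blast
  qed
  then show ?thesis
    using class_B_partition_of_edge[OF C4 side_stable[OF C4 u] side_stable[OF C4' u(2,1)]]
      apex_neighbours[OF C4] unfolding adj_class_B_def by blast
qed

subsection \<open>4-holes without triangles on their edges\<close>

lemma side_stable_if_no_triangle:
  assumes no_triangle: "\<nexists>a b c d u. induced_C4 E a b c d \<and> E u a \<and> E u b"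
    and C4: "induced_C4 E a b c d"
  shows "stable_in E {v \<in> V. E v b \<and> \<not> E v a}"
  unfolding stable_in_def
proof (intro ballI notI)
  fix p q
  assume "p \<in> {v \<in> V. E v b \<and> \<not> E v a}" "q \<in> {v \<in> V. E v b \<and> \<not> E v a}" "E p q"
  then have pq: "E p b" "\<not> E p a" "E q b" "\<not> E q a" "E p q" "p \<noteq> a" "q \<noteq> a"
    using sym by blast+
  have "\<not> E p d" if p: "E p b" "\<not> E p a" "p \<noteq> a" and "E q b" "E q p" for p q
  proof
    assume "E p d"
    then have "induced_C4 E b p d a" using C4_rotate[OF side_adj_imp_C4[OF C4 p]] by blast
    then show False using no_triangle \<open>E q b\<close> \<open>E q p\<close> by blast
  qed
  then have "\<not> E p d" "\<not> E q d"
    using pq sym by blast+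
  moreover have "\<not> E p c" "\<not> E q c"
    using no_triangle C4_rotate[OF C4] pq by blast+
  ultimately show False
    using no_2K2[of c d p q] pq C4 by (simp add: induced_defs adj_commute)
qed

text \<open>A vertex \<open>p\<close> violating the conclusion would be adjacent to all neighbours of \<open>a\<close>, and to \<open>w\<close>.\<close>

lemma non_neighbour_not_adj_side_if_no_triangle:
  assumes no_triangle: "\<nexists>a b c d u. induced_C4 E a b c d \<and> E u a \<and> E u b"
    and C4: "induced_C4 E a b c d"
    and max: "\<forall>p c d. induced_C4 E p b c d \<longrightarrow> degree_in E V p \<le> degree_in E V a"
    and w: "\<not> E w a" "\<not> E w b" and p: "E p b" "\<not> E p a"
  shows "\<not> E w p"
proof
  assume "E w p"
  have adj_p: "E p t" if "E a t" for t
  proof (cases "t = b")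
    case False
    moreover have "\<not> E t b" using no_triangle C4 that sym by blast
    ultimately show ?thesis
      using no_C5[of a b p w t] no_2K2[of a t p w] that w p \<open>E w p\<close> C4
      by (auto simp: induced_defs adj_commute)
  qed (use p sym in blast)
  have "w \<in> {t \<in> V. E p t} - {t \<in> V. E a t}"
    using in_V[OF \<open>E w p\<close>] w \<open>E w p\<close> sym by blast
  then have "{t \<in> V. E a t} \<subset> {t \<in> V. E p t}"
    using adj_p by blast
  then have "degree_in E V a < degree_in E V p"
    unfolding degree_in_def using finite_V by (intro psubset_card_mono) auto
  moreover have "induced_C4 E p b a d"
    using C4 p w \<open>E w p\<close> adj_p[of d] sym by (auto simp: induced_defs adj_commute)
  ultimately show False using max by fastforce
qed

lemma C4_with_max_degree_sum:
  assumes "induced_C4 E a b c d"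
  obtains a b c d where "induced_C4 E a b c d"
    and "\<And>a' b' c' d'. induced_C4 E a' b' c' d' \<Longrightarrow>
      degree_in E V a' + degree_in E V b' \<le> degree_in E V a + degree_in E V b"
proof -
  have "degree_in E V v \<le> card V" for v
    unfolding degree_in_def by (intro card_mono finite_V) blast
  then have bound: "degree_in E V v + degree_in E V w < Suc (card V + card V)" for v w
    by (simp add: add_mono less_Suc_eq_le)
  let ?C4 = "\<lambda>(a, b, c, d). induced_C4 E a b c d"
  let ?sum = "\<lambda>(a, b, c, d). degree_in E V a + degree_in E V b"
  obtain h where "?C4 h" "\<forall>h'. ?C4 h' \<longrightarrow> ?sum h' \<le> ?sum h"
    using ex_has_greatest_nat[of ?C4 "(a, b, c, d)" ?sum "Suc (card V + card V)"] assms bound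
    by (auto simp: split_beta)
  then show thesis
    by (cases h) (auto intro!: that)
qed

lemma adj_class_B_of_C4:
  assumes "induced_C4 E a b c d"
  shows "adj_class_B V E"
proof (cases "\<exists>a b c d u. induced_C4 E a b c d \<and> E u a \<and> E u b")
  case True
  then show ?thesis using adj_class_B_of_triangle_on_C4 by blast
next
  case no_triangle: False
  obtain a b c d where C4: "induced_C4 E a b c d"
    and max: "\<And>a' b' c' d'. induced_C4 E a' b' c' d' \<Longrightarrow>
      degree_in E V a' + degree_in E V b' \<le> degree_in E V a + degree_in E V b"
    using C4_with_max_degree_sum[OF assms] by blast
  note C4' = C4_reflect[OF C4]
  have max_a: "\<forall>p c d. induced_C4 E p b c d \<longrightarrow> degree_in E V p \<le> degree_in E V a"
    and max_b: "\<forall>p c d. induced_C4 E p a c d \<longrightarrow> degree_in E V p \<le> degree_in E V b"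
    using max C4_reflect by fastforce+
  have "\<not> E w p" if w: "\<not> E w a" "\<not> E w b" for w p
  proof
    assume "E w p"
    moreover have "E p a \<or> E p b"
      using no_2K2[of w p a b] \<open>E w p\<close> w C4 unfolding induced_defs by blast
    moreover have "\<not> (E p a \<and> E p b)" using no_triangle C4 by blast
    ultimately show False
      using non_neighbour_not_adj_side_if_no_triangle[OF no_triangle C4 max_a w]
        non_neighbour_not_adj_side_if_no_triangle[OF no_triangle C4' max_b w(2,1)] by blast
  qed
  moreover have "v = a \<or> v = b" if "E z a" "E z b" "E z v" for z v
    using no_triangle C4 that by blast
  ultimately show ?thesis
    using class_B_partition_of_edge[OF C4 side_stable_if_no_triangle[OF no_triangle C4]
        side_stable_if_no_triangle[OF no_triangle C4']]
    unfolding adj_class_B_def by blast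
qed

end

section \<open>Split graphs\<close>

context sgraph
begin

lemma non_neighbours_of_max_degree_stable:
  assumes no_C4: "\<And>a b c d. \<not> induced_C4 E a b c d"
    and no_2K2: "\<And>p q r s. \<not> induced_2K2 E p q r s"
    and no_C5: "\<And>a b c d e. \<not> induced_C5 E a b c d e"
    and W: "finite W" "v \<in> W" and max: "\<And>u. u \<in> W \<Longrightarrow> degree_in E W u \<le> degree_in E W v"
  shows "stable_in E {u \<in> W. \<not> E v u}"
  unfolding stable_in_def
proof (intro ballI notI)
  fix x y
  assume x: "x \<in> {u \<in> W. \<not> E v u}" and y: "y \<in> {u \<in> W. \<not> E v u}" and "E x y"
  have missed: "\<exists>w. E v w \<and> \<not> E x w"
    if x: "x \<in> {u \<in> W. \<not> E v u}" and y: "y \<in> {u \<in> W. \<not> E v u}" and "E x y" for x y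
  proof (rule ccontr)
    assume "\<not> ?thesis"
    then have "{u \<in> W. E v u} \<subset> {u \<in> W. E x u}" using y \<open>E x y\<close> by blast
    then have "degree_in E W v < degree_in E W x"
      unfolding degree_in_def using W(1) by (intro psubset_card_mono) auto
    then show False using max[of x] x by simp
  qed
  obtain w where w: "E v w" "\<not> E x w" using missed[OF x y \<open>E x y\<close>] by blast
  obtain w' where w': "E v w'" "\<not> E y w'" using missed[OF y x] \<open>E x y\<close> sym by blast
  have neq: "w \<noteq> x" "w' \<noteq> y" using w w' x y by auto
  have "E y w" "E x w'"
    using no_2K2[of v w x y] no_2K2[of v w' x y] w w' x y \<open>E x y\<close>
    by (auto simp: induced_2K2_def adj_commute)
  show False
  proof (cases "E w w'")
    case True
    then have "induced_C4 E w w' x y"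
      using w w' neq \<open>E y w\<close> \<open>E x w'\<close> \<open>E x y\<close> by (auto simp: induced_C4_def adj_commute)
    then show False using no_C4 by blast
  next
    case False
    then have "induced_C5 E v w y x w'"
      using w w' x y \<open>E y w\<close> \<open>E x w'\<close> \<open>E x y\<close> by (auto simp: induced_C5_def adj_commute)
    then show False using no_C5 by blast
  qed
qed

lemma split_partition_with_maximal_clique:
  assumes K: "K \<subseteq> W" "pairwise E K" "stable_in E (W - K)"
  obtains L where "L \<subseteq> W" "pairwise E L" "stable_in E (W - L)"
    and "\<And>s. s \<in> W - L \<Longrightarrow> \<exists>k\<in>L. \<not> E s k"
proof (cases "\<exists>s\<in>W - K. \<forall>k\<in>K. E s k")
  case True
  then obtain s where s: "s \<in> W - K" "\<forall>k\<in>K. E s k" by blast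
  show thesis
  proof (rule that[of "insert s K"])
    show "pairwise E (insert s K)"
      using K(2) s sym by (auto simp: pairwise_insert)
    show "\<exists>k\<in>insert s K. \<not> E t k" if "t \<in> W - insert s K" for t
      using that K(3) s(1) unfolding stable_in_def by blast
  qed (use K s in \<open>auto simp: stable_in_def\<close>)
next
  case False
  then show thesis using that[OF K] by blast
qed

lemma split_partition_exchange:
  assumes no_C4: "\<And>a b c d. \<not> induced_C4 E a b c d"
    and K: "K \<subseteq> W - {v}" "pairwise E K" "stable_in E (W - {v} - K)"
    and maximal: "\<And>s. s \<in> W - {v} - K \<Longrightarrow> \<exists>k\<in>K. \<not> E s k"
    and non_nbrs: "stable_in E {u \<in> W. \<not> E v u}"
    and k: "k \<in> K" "\<not> E v k"
  shows "pairwise E (insert v (K - {k}))" "stable_in E (W - insert v (K - {k}))"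
proof -
  have v_adj: "E v k'" if "k' \<in> K - {k}" for k'
    using that K(1,2) k non_nbrs unfolding stable_in_def pairwise_def by blast
  then show "pairwise E (insert v (K - {k}))"
    using K(2) sym by (auto simp: pairwise_insert pairwise_def)
  have "\<not> E s k" if s: "s \<in> W - {v} - K" for s
  proof
    assume "E s k"
    moreover have "k \<in> W" "s \<in> W" using k K(1) s by blast+
    ultimately have "E v s" using k(2) non_nbrs unfolding stable_in_def by blast
    have "E s k'" if "k' \<in> K - {k}" for k'
    proof (rule ccontr)
      assume "\<not> E s k'"
      moreover have "E k k'" using pairwiseD(1)[OF K(2)] k that by blast
      ultimately have "induced_C4 E v s k k'"
        using \<open>E s k\<close> \<open>E v s\<close> v_adj[OF that] k K(1) s that
        by (auto simp: induced_C4_def adj_commute)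
      then show False using no_C4 by blast
    qed
    then show False using maximal[OF s] \<open>E s k\<close> by blast
  qed
  then have "stable_in E (insert k (W - {v} - K))"
    using K(3) irrefl by (auto simp: stable_in_def adj_commute)
  then show "stable_in E (W - insert v (K - {k}))"
    unfolding stable_in_def by blast
qed

lemma split_partition_exists:
  assumes no_C4: "\<And>a b c d. \<not> induced_C4 E a b c d"
    and no_2K2: "\<And>p q r s. \<not> induced_2K2 E p q r s"
    and no_C5: "\<And>a b c d e. \<not> induced_C5 E a b c d e"
    and "finite W"
  obtains K where "K \<subseteq> W" "pairwise E K" "stable_in E (W - K)"
  using \<open>finite W\<close>
proof (induction "card W" arbitrary: W thesis)
  case 0
  then show ?case by (auto simp: stable_in_def)
next
  case (Suc n)
  obtain v where v: "v \<in> W" and max: "\<And>u. u \<in> W \<Longrightarrow> degree_in E W u \<le> degree_in E W v"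
  proof -
    have "W \<noteq> {}" using Suc.hyps(2) by auto
    then have "Max (degree_in E W ` W) \<in> degree_in E W ` W"
      using \<open>finite W\<close> by (intro Max_in) auto
    then show thesis using that Max_ge[of "degree_in E W ` W"] \<open>finite W\<close> by fastforce
  qed
  have stable_non_nbrs: "stable_in E {u \<in> W. \<not> E v u}"
    using non_neighbours_of_max_degree_stable[OF no_C4 no_2K2 no_C5 \<open>finite W\<close> v max] .
  obtain K0 where "K0 \<subseteq> W - {v}" "pairwise E K0" "stable_in E (W - {v} - K0)"
    using Suc v by (metis card_Diff_singleton diff_Suc_1 finite_Diff)
  then obtain K where K: "K \<subseteq> W - {v}" "pairwise E K" "stable_in E (W - {v} - K)"
    and maximal: "\<And>s. s \<in> W - {v} - K \<Longrightarrow> \<exists>k\<in>K. \<not> E s k"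
    by (rule split_partition_with_maximal_clique) blast
  show ?case
  proof (cases "\<forall>k\<in>K. E v k")
    case True
    then have "pairwise E (insert v K)" using K(2) sym by (auto simp: pairwise_insert)
    moreover have "W - insert v K = W - {v} - K" by blast
    ultimately show ?thesis using Suc.prems(1)[of "insert v K"] K v by auto
  next
    case False
    then obtain k where k: "k \<in> K" "\<not> E v k" by blast
    show ?thesis
      using Suc.prems(1)[of "insert v (K - {k})"] K(1) v
        split_partition_exchange[OF no_C4 K maximal stable_non_nbrs k] by blast
  qed
qed

end

section \<open>The structure theorem\<close>

definition adj_split :: "'a set \<Rightarrow> ('a \<Rightarrow> 'a \<Rightarrow> bool) \<Rightarrow> bool" where
  "adj_split V E \<longleftrightarrow> (\<exists>K\<subseteq>V. pairwise E K \<and> stable_in E (V - K))"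

definition adj_basic :: "'a set \<Rightarrow> ('a \<Rightarrow> 'a \<Rightarrow> bool) \<Rightarrow> bool" where
  "adj_basic V E \<longleftrightarrow> (\<exists>a b c d e. induced_C5 E a b c d e \<and> V = {a, b, c, d, e}) \<or>
     (\<exists>a b c d e f. induced_C6 E a b c d e f \<and> V = {a, b, c, d, e, f}) \<or>
     adj_split V E \<or> adj_class_A V E \<or> adj_class_B V E \<or> adj_class_C V E"

lemma adj_basicI:
  "\<lbrakk>induced_C5 E a b c d e; V = {a, b, c, d, e}\<rbrakk> \<Longrightarrow> adj_basic V E"
  "\<lbrakk>induced_C6 E a b c d e f; V = {a, b, c, d, e, f}\<rbrakk> \<Longrightarrow> adj_basic V E"
  "adj_split V E \<Longrightarrow> adj_basic V E"
  "adj_class_A V E \<Longrightarrow> adj_basic V E"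
  "adj_class_B V E \<Longrightarrow> adj_basic V E"
  "adj_class_C V E \<Longrightarrow> adj_basic V E"
  unfolding adj_basic_def by metis+

lemma (in exceptional_hole_free) adj_basic_if_pair_sharing:
  assumes "pair_sharing E"
  shows "adj_basic V E \<or> adj_basic V (compl_adj V E)"
proof -
  interpret compl: exceptional_hole_free V "compl_adj V E"
    by (rule exceptional_hole_free_compl_adj)
  consider a b c d u v where "edge_sharing E a b c d u v"
    | a b c d u v where "edge_sharing (compl_adj V E) a b c d u v"
    using assms nonedge_sharing_imp_compl_edge_sharing unfolding pair_sharing_def by blast
  then show ?thesis
    using adj_class_A_or_C_if_edge_sharing compl.adj_class_A_or_C_if_edge_sharing adj_basicI(4,6)
    unfolding compl_adj_compl_adj by cases blast+
qed

lemma (in exceptional_hole_free) adj_basic_of_exceptional_hole_free: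
  "adj_basic V E \<or> adj_basic V (compl_adj V E)"
proof -
  consider (both) a b c d p q r s where "induced_C4 E a b c d" "induced_2K2 E p q r s"
    | (C4) a b c d where "induced_C4 E a b c d" "\<forall>p q r s. \<not> induced_2K2 E p q r s"
    | (two_K2) p q r s where "induced_2K2 E p q r s" "\<forall>a b c d. \<not> induced_C4 E a b c d"
    | (none) "\<forall>a b c d. \<not> induced_C4 E a b c d" "\<forall>p q r s. \<not> induced_2K2 E p q r s"
    by metis
  then show ?thesis
  proof cases
    case both
    then show ?thesis
      by (intro adj_basic_if_pair_sharing pair_sharing_if_C4_2K2)
  next
    case C4
    then interpret two_K2_free V E by unfold_locales blast
    show ?thesis using adj_class_B_of_C4[OF C4(1)] adj_basicI(5) by blast
  next
    case two_K2
    interpret compl: exceptional_hole_free V "compl_adj V E"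
      by (rule exceptional_hole_free_compl_adj)
    interpret compl: two_K2_free V "compl_adj V E"
      using two_K2(2) C4_of_compl_2K2 by unfold_locales blast
    show ?thesis
      using compl.adj_class_B_of_C4[OF compl_C4_of_2K2[OF two_K2(1)]] adj_basicI(5) by blast
  next
    case none
    then obtain K where "K \<subseteq> V" "pairwise E K" "stable_in E (V - K)"
      using split_partition_exists[OF _ _ no_C5 finite_V] by metis
    then show ?thesis using adj_basicI(3) unfolding adj_split_def by blast
  qed
qed

theorem (in small_wheel_rules) adj_basic_or_compl: "adj_basic V E \<or> adj_basic V (compl_adj V E)"
proof (cases "exceptional_hole_free V E")
  case True
  then show ?thesis by (rule exceptional_hole_free.adj_basic_of_exceptional_hole_free)
next
  case False
  then consider (C5) a b c d e where "induced_C5 E a b c d e"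
    | (C6) a b c d e f where "induced_C6 E a b c d e f"
    | (co_C6) a b c d e f where "induced_co_C6 E a b c d e f"
    using small_wheel_rules_axioms
    unfolding exceptional_hole_free_def exceptional_hole_free_axioms_def by blast
  then show ?thesis
  proof cases
    case C5
    from adj_basicI(1)[OF this C5_spans[OF this]] show ?thesis ..
  next
    case C6
    from adj_basicI(2)[OF this C6_spans[OF this]] show ?thesis ..
  next
    case co_C6
    from adj_basicI(2)[OF compl_C6_of_co_C6[OF this] co_C6_spans[OF this]] show ?thesis ..
  qed
qed

section \<open>The basic graphs satisfy the rules\<close>

subsection \<open>Simplicial vertices and bipartitions\<close>

definition simplicial :: "('a \<Rightarrow> 'a \<Rightarrow> bool) \<Rightarrow> 'a set \<Rightarrow> 'a \<Rightarrow> bool" where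
  "simplicial E S v \<longleftrightarrow> pairwise E {u \<in> S. E v u}"

definition bipartition :: "('a \<Rightarrow> 'a \<Rightarrow> bool) \<Rightarrow> 'a set \<Rightarrow> 'a set \<Rightarrow> bool" where
  "bipartition E S A \<longleftrightarrow> (\<forall>u\<in>S. \<forall>v\<in>S. E u v \<longrightarrow> (u \<in> A \<longleftrightarrow> v \<notin> A))"

context sgraph
begin

lemma simplicialD:
  "\<lbrakk>simplicial E S v; u \<in> S; w \<in> S; E v u; E v w; u \<noteq> w\<rbrakk> \<Longrightarrow> E u w"
  unfolding simplicial_def pairwise_def by blast

lemma
  assumes "simplicial E T v"
  shows simplicial_not_in_C4:
      "\<lbrakk>induced_C4 E a b c d; {a, b, c, d} \<subseteq> T\<rbrakk> \<Longrightarrow> v \<notin> {a, b, c, d}"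
    and simplicial_not_in_C5:
      "\<lbrakk>induced_C5 E a b c d e; {a, b, c, d, e} \<subseteq> T\<rbrakk> \<Longrightarrow> v \<notin> {a, b, c, d, e}"
    and simplicial_not_in_C6:
      "\<lbrakk>induced_C6 E a b c d e f; {a, b, c, d, e, f} \<subseteq> T\<rbrakk> \<Longrightarrow> v \<notin> {a, b, c, d, e, f}"
    and simplicial_not_in_co_C6:
      "\<lbrakk>induced_co_C6 E a b c d e f; {a, b, c, d, e, f} \<subseteq> T\<rbrakk> \<Longrightarrow> v \<notin> {a, b, c, d, e, f}"
proof -
  have no_non_adj_neighbours: False if "E v u" "E v w" "\<not> E u w" "u \<noteq> w" "u \<in> T" "w \<in> T" for u w
    using that simplicialD[OF assms] by blast
  show "v \<notin> {a, b, c, d}" if "induced_C4 E a b c d" "{a, b, c, d} \<subseteq> T"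
    using that no_non_adj_neighbours sym distinct_C4[OF that(1)] unfolding induced_C4_def by auto
  show "v \<notin> {a, b, c, d, e}" if "induced_C5 E a b c d e" "{a, b, c, d, e} \<subseteq> T"
    using that no_non_adj_neighbours sym distinct_C5[OF that(1)] unfolding induced_C5_def by auto
  show "v \<notin> {a, b, c, d, e, f}" if "induced_C6 E a b c d e f" "{a, b, c, d, e, f} \<subseteq> T"
    using that no_non_adj_neighbours sym distinct_C6[OF that(1)] unfolding induced_C6_def by auto
  show "v \<notin> {a, b, c, d, e, f}" if "induced_co_C6 E a b c d e f" "{a, b, c, d, e, f} \<subseteq> T"
    using that no_non_adj_neighbours sym distinct_co_C6[OF that(1)] unfolding induced_co_C6_def
    by auto
qed

lemma cosimplicial_not_in_2K2:
  assumes "simplicial (compl_adj V E) T v" "induced_2K2 E p q r s" "{p, q, r, s} \<subseteq> T"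
  shows "v \<notin> {p, q, r, s}"
  using sgraph.simplicial_not_in_C4[OF sgraph_compl_adj assms(1) compl_C4_of_2K2[OF assms(2)]]
    assms(3) by blast

lemma bipartitionD: "\<lbrakk>bipartition E S A; E u v; u \<in> S; v \<in> S\<rbrakk> \<Longrightarrow> u \<in> A \<longleftrightarrow> v \<notin> A"
  unfolding bipartition_def by blast

lemma bipartition_imp_no_triangle:
  assumes "bipartition E S A" "{u, v, w} \<subseteq> S" "E u v" "E v w"
  shows "\<not> E w u"
  using assms(2-) bipartitionD[OF assms(1), of u v] bipartitionD[OF assms(1), of v w]
    bipartitionD[OF assms(1), of w u] by auto

lemma bipartition_imp_no_C5:
  assumes "bipartition E S A" "{a, b, c, d, e} \<subseteq> S"
  shows "\<not> induced_C5 E a b c d e"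
  using assms(2) bipartitionD[OF assms(1), of a b] bipartitionD[OF assms(1), of b c]
    bipartitionD[OF assms(1), of c d] bipartitionD[OF assms(1), of d e]
    bipartitionD[OF assms(1), of e a] by (auto simp: induced_C5_def)

lemma V_eq_if_card_le:
  assumes "distinct xs" "set xs \<subseteq> V" "card V \<le> length xs"
  shows "V = set xs"
  using assms card_subset_eq[OF finite_V assms(2)] card_mono[OF finite_V assms(2)]
  by (simp add: distinct_card)

lemma C5_spans_if_card_le:
  assumes "card V \<le> 5" "induced_C5 E a b c d e"
  shows "V = {a, b, c, d, e}"
  using V_eq_if_card_le[OF distinct_C5[OF assms(2)]] C5_subset[OF assms(2)] assms(1) by simp

lemma co_C6_spans_if_card_le:
  assumes "card V \<le> 6" "induced_co_C6 E a b c d e f"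
  shows "V = {a, b, c, d, e, f}"
  using V_eq_if_card_le[OF distinct_co_C6[OF assms(2)]] co_C6_subset[OF assms(2)] assms(1) by simp

subsection \<open>The 5-hole and split graphs\<close>

lemma spanning_C5_degree_le:
  assumes C5: "induced_C5 E a b c d e" and V: "V = {a, b, c, d, e}"
    and adj: "E v p" "E v q" "E v r"
  shows "p = q \<or> q = r \<or> p = r"
proof -
  have "E a u \<Longrightarrow> u = b \<or> u = e" "E b u \<Longrightarrow> u = a \<or> u = c" "E c u \<Longrightarrow> u = b \<or> u = d"
    "E d u \<Longrightarrow> u = c \<or> u = e" "E e u \<Longrightarrow> u = d \<or> u = a" for u
    using in_V2[of _ u] C5 irrefl sym unfolding V induced_C5_def by blast+
  moreover have "v \<in> {a, b, c, d, e}" using in_V[OF adj(1)] V by blast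
  ultimately show ?thesis using adj by (elim insertE emptyE) metis+
qed

lemma C4_rule_of_C5:
  assumes "induced_C5 E a b c d e" "V = {a, b, c, d, e}"
    and C4: "induced_C4 E p q r s" and adj: "E v p" "E v q" "E v r"
  shows False
  using spanning_C5_degree_le[OF assms(1,2) adj] distinct_C4[OF C4] by simp

lemma small_wheel_rules_of_C5:
  assumes C5: "induced_C5 E a b c d e" and V: "V = {a, b, c, d, e}"
  shows "small_wheel_rules V E"
proof -
  interpret compl: sgraph V "compl_adj V E" by (rule sgraph_compl_adj)
  have "V = {a, c, e, b, d}" using V by blast
  then interpret compl: C4_wheel_free V "compl_adj V E"
    by unfold_locales (rule compl.C4_rule_of_C5[OF compl_C5_of_C5[OF C5]])
  have card: "card V = 5" using V distinct_C5[OF C5] by simp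
  have no_six: False if "distinct [p, q, r, s, t, u]" "{p, q, r, s, t, u} \<subseteq> V" for p q r s t u
    using card_mono[OF finite_V that(2)] that(1) card by simp
  show ?thesis
  proof
    show False if "induced_C4 E p q r s" "E v p" "E v q" "E v r" for p q r s v
      using C4_rule_of_C5[OF C5 V that] .
    show False
      if "induced_2K2 E p q r s" "v \<in> V" "v \<noteq> r" "\<not> E v p" "\<not> E v q" "\<not> E v r" for p q r s v
      using compl.compl_two_K2_rule that unfolding compl_adj_compl_adj by blast
    show "V = {p, q, r, s, t}" if "induced_C5 E p q r s t" for p q r s t
      using C5_spans_if_card_le[OF _ that] card by simp
    show "V = {p, q, r, s, t, u}" if "induced_C6 E p q r s t u" for p q r s t u
      using no_six[OF distinct_C6[OF that] C6_subset[OF that]] by blast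
    show "V = {p, q, r, s, t, u}" if "induced_co_C6 E p q r s t u" for p q r s t u
      using no_six[OF distinct_co_C6[OF that] co_C6_subset[OF that]] by blast
  qed
qed

lemma small_wheel_rules_of_split:
  assumes "adj_split V E"
  shows "small_wheel_rules V E"
proof -
  obtain K where K: "K \<subseteq> V" "pairwise E K" "stable_in E (V - K)"
    using assms unfolding adj_split_def by blast
  have edge: "u \<in> K \<or> v \<in> K" if "E u v" for u v
    using that K(3) in_V in_V2 unfolding stable_in_def by blast
  have no_C4: "\<not> induced_C4 E a b c d" for a b c d
    using edge[of a b] edge[of b c] edge[of c d] edge[of d a] K(2)
    unfolding induced_C4_def pairwise_def by blast
  moreover have no_2K2: "\<not> induced_2K2 E p q r s" for p q r s
  proof
    assume two_K2: "induced_2K2 E p q r s"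
    then have "p \<noteq> r" "p \<noteq> s" "q \<noteq> r" "q \<noteq> s"
      using sym unfolding induced_2K2_def by blast+
    with two_K2 show False
      using edge[of p q] edge[of r s] K(2) unfolding induced_2K2_def pairwise_def by blast
  qed
  moreover have "\<not> induced_C5 E a b c d e" for a b c d e
    using edge[of a b] edge[of b c] edge[of c d] edge[of d e] edge[of e a] K(2)
      distinct_C5[of a b c d e]
    unfolding induced_C5_def pairwise_def by auto
  ultimately show ?thesis
    using C6_imp_2K2 co_C6_imp_C4 by unfold_locales metis+
qed

end

subsection \<open>The class A\<close>

context class_A_partition
begin

lemma e_neighbours: "E e u \<Longrightarrow> u \<in> X \<or> u = c \<or> u = d"
  using e_anticomplete V_eq in_V2 irrefl by blast

lemma insert_e_clique: "\<lbrakk>s \<in> insert e X; t \<in> insert e X; s \<noteq> t\<rbrakk> \<Longrightarrow> E s t"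
  using pairwiseD(1)[OF X_clique, of s t] e_complete sym by blast

lemma simplicial_e: "simplicial E V e"
  unfolding simplicial_def
proof (rule pairwiseI)
  fix u w assume "u \<in> {u \<in> V. E e u}" "w \<in> {u \<in> V. E e u}" "u \<noteq> w"
  then show "E u w"
    using e_neighbours[of u] e_neighbours[of w] e_not_both pairwiseD(1)[OF X_clique, of u w]
      X_complete sym by blast
qed

lemma simplicial_X:
  assumes "s \<in> X"
  shows "simplicial E (V - {e}) s"
  unfolding simplicial_def
proof (rule pairwiseI)
  fix u w assume uw: "u \<in> {u \<in> V - {e}. E s u}" "w \<in> {u \<in> V - {e}. E s u}" "u \<noteq> w"
  then have "u \<in> X \<union> {c, d}" "w \<in> X \<union> {c, d}"
    using X_anticomplete[OF assms] V_eq by blast+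
  then show "E u w"
    using uw pairwiseD(1)[OF X_clique, of u w] X_complete hole sym unfolding induced_C4_def by blast
qed

lemma cosimplicial_c: "simplicial (compl_adj V E) V c"
  and cosimplicial_d: "simplicial (compl_adj V E) V d"
proof -
  have "{u \<in> V. compl_adj V E c u} \<subseteq> {a, e}" "{u \<in> V. compl_adj V E d u} \<subseteq> {b, e}"
    using V_eq X_complete hole sym unfolding compl_adj_def induced_C4_def by blast+
  moreover have "pairwise (compl_adj V E) {a, e}" "pairwise (compl_adj V E) {b, e}"
    using V_eq e_anticomplete sym unfolding compl_adj_def pairwise_def by blast+
  ultimately show "simplicial (compl_adj V E) V c" "simplicial (compl_adj V E) V d"
    unfolding simplicial_def using pairwise_subset by blast+
qed

lemma C4_subset_hole:
  assumes "induced_C4 E p q r s"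
  shows "{p, q, r, s} \<subseteq> {a, b, c, d}"
proof -
  have sub: "{p, q, r, s} \<subseteq> V - {e}"
    using simplicial_not_in_C4[OF simplicial_e assms C4_subset[OF assms]] C4_subset[OF assms]
    by blast
  then show ?thesis
    using simplicial_not_in_C4[OF simplicial_X assms sub] V_eq by blast
qed

lemma length_le_if_subset_hole:
  assumes "distinct xs" "set xs \<subseteq> {a, b, c, d}"
  shows "length xs \<le> 4"
  using card_mono[OF _ assms(2)] distinct distinct_card[OF assms(1)] by simp

lemma no_C5: "\<not> induced_C5 E p q r t u"
proof
  assume C5: "induced_C5 E p q r t u"
  have sub: "{p, q, r, t, u} \<subseteq> V - {e}"
    using simplicial_not_in_C5[OF simplicial_e C5 C5_subset[OF C5]] C5_subset[OF C5] by blast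
  then have "{p, q, r, t, u} \<subseteq> {a, b, c, d}"
    using simplicial_not_in_C5[OF simplicial_X C5 sub] V_eq by blast
  then show False using length_le_if_subset_hole[OF distinct_C5[OF C5]] by simp
qed

lemma no_C6: "\<not> induced_C6 E p q r t u w"
proof
  assume C6: "induced_C6 E p q r t u w"
  have sub: "{p, q, r, t, u, w} \<subseteq> V - {e}"
    using simplicial_not_in_C6[OF simplicial_e C6 C6_subset[OF C6]] C6_subset[OF C6] by blast
  then have "{p, q, r, t, u, w} \<subseteq> {a, b, c, d}"
    using simplicial_not_in_C6[OF simplicial_X C6 sub] V_eq by blast
  then show False using length_le_if_subset_hole[OF distinct_C6[OF C6]] by simp
qed

lemma no_co_C6: "\<not> induced_co_C6 E p q r t u w"
proof
  assume co_C6: "induced_co_C6 E p q r t u w"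
  then have rotated: "induced_co_C6 E q r t u w p"
    using sym unfolding induced_co_C6_def by blast
  have "{p, q, r, t, u, w} \<subseteq> {a, b, c, d}"
    using C4_subset_hole[OF co_C6_imp_C4[OF co_C6]] C4_subset_hole[OF co_C6_imp_C4[OF rotated]]
    by simp
  then show False using length_le_if_subset_hole[OF distinct_co_C6[OF co_C6]] by simp
qed

lemma two_K2_cases:
  assumes two_K2: "induced_2K2 E p q r s"
  shows "{p, q} = {a, b} \<and> {r, s} \<subseteq> insert e X \<or> {r, s} = {a, b} \<and> {p, q} \<subseteq> insert e X"
proof -
  have in_parts: "x \<in> {a, b} \<or> x \<in> insert e X" if "x \<in> {p, q, r, s}" for x
    using cosimplicial_not_in_2K2[OF cosimplicial_c two_K2 two_K2_subset[OF two_K2]]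
      cosimplicial_not_in_2K2[OF cosimplicial_d two_K2 two_K2_subset[OF two_K2]]
      two_K2_subset[OF two_K2] V_eq that
    by blast
  have apart: "x \<in> {a, b} \<longleftrightarrow> y \<in> {a, b}" if "E x y" "x \<in> {p, q, r, s}" "y \<in> {p, q, r, s}" for x y
    using that in_parts[of x] in_parts[of y] X_anticomplete e_anticomplete sym by blast
  have neq: "p \<noteq> q" "r \<noteq> s" "p \<noteq> r" "p \<noteq> s" "q \<noteq> r" "q \<noteq> s"
    using two_K2 irrefl sym unfolding induced_2K2_def by blast+
  have pq: "p \<in> {a, b} \<longleftrightarrow> q \<in> {a, b}" and rs: "r \<in> {a, b} \<longleftrightarrow> s \<in> {a, b}"
    using apart[of p q] apart[of r s] two_K2 unfolding induced_2K2_def by blast+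
  show ?thesis
  proof (cases "p \<in> {a, b}")
    case True
    then have "{p, q} = {a, b}" using pq neq by auto
    moreover from this have "r \<notin> {a, b}" "s \<notin> {a, b}" using neq by auto
    ultimately show ?thesis using in_parts[of r] in_parts[of s] by blast
  next
    case False
    then have "p \<in> insert e X" "q \<in> insert e X"
      using pq in_parts[of p] in_parts[of q] by blast+
    moreover from this have "r \<notin> insert e X"
      using insert_e_clique[of p r] neq two_K2 unfolding induced_2K2_def by blast
    then have "{r, s} = {a, b}" using in_parts[of r] rs neq by auto
    ultimately show ?thesis by blast
  qed
qed

lemma C4_rule:
  assumes C4: "induced_C4 E p q r s" and v: "E v p" "E v q" "E v r"
  shows False
proof -
  have sub: "p \<in> {a, b, c, d}" "q \<in> {a, b, c, d}" "r \<in> {a, b, c, d}"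
    using C4_subset_hole[OF C4] by blast+
  have neq: "p \<noteq> q" "q \<noteq> r" "p \<noteq> r" using distinct_C4[OF C4] by auto
  have "E v a \<or> E v b"
    using v sub neq by auto
  then have "v \<notin> insert e X" using X_anticomplete e_anticomplete by blast
  then have "v \<in> {a, b, c, d}" using in_V[OF v(1)] V_eq by blast
  then show False
    using v sub neq hole irrefl by (auto simp: induced_C4_def adj_commute)
qed

lemma two_K2_rule:
  assumes two_K2: "induced_2K2 E p q r s" and v: "v \<in> V" "v \<noteq> r" "\<not> E v p" "\<not> E v q" "\<not> E v r"
  shows False
proof -
  have "v \<noteq> p" "v \<noteq> q" "p \<noteq> q" using two_K2 v sym irrefl unfolding induced_2K2_def by blast+
  show False
    using two_K2_cases[OF two_K2]
  proof
    assume parts: "{p, q} = {a, b} \<and> {r, s} \<subseteq> insert e X"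
    then have "\<not> E v a" "\<not> E v b" "v \<noteq> a" "v \<noteq> b"
      using v \<open>v \<noteq> p\<close> \<open>v \<noteq> q\<close> by (auto simp: doubleton_eq_iff)
    then have "v \<in> insert e X"
      using v(1) V_eq hole by (auto simp: induced_C4_def adj_commute)
    then show False using insert_e_clique parts v by blast
  next
    assume parts: "{r, s} = {a, b} \<and> {p, q} \<subseteq> insert e X"
    then have "v \<notin> insert e X" using insert_e_clique[of v p] v(3) \<open>v \<noteq> p\<close> by blast
    moreover have "p \<in> X \<or> q \<in> X" using parts \<open>p \<noteq> q\<close> by blast
    then have "v \<notin> {c, d}" using v X_complete sym by blast
    ultimately have "v \<in> {a, b}" using v(1) V_eq by blast
    then show False
      using parts v(2,5) hole by (auto simp: induced_C4_def doubleton_eq_iff adj_commute)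
  qed
qed

lemma small_wheel_rules: "small_wheel_rules V E"
  by unfold_locales (fact C4_rule two_K2_rule | simp add: no_C5 no_C6 no_co_C6)+

end

subsection \<open>The class B\<close>

context class_B_partition
begin

lemma Z_neighbours:
  assumes "z \<in> Z" "E z v"
  shows "v = x \<or> v = y"
proof -
  have "v \<notin> Z" using assms stable_parts(3) unfolding stable_in_def by blast
  moreover have "v \<notin> W" using W_isolated[of v z] assms in_V sym by blast
  ultimately show ?thesis using Z_anticomplete[of z v] assms in_V2 V_eq by blast
qed

lemma simplicial_Z: "z \<in> Z \<Longrightarrow> simplicial E V z"
  using Z_neighbours x_complete[OF y_in] y_complete[OF x_in]
  unfolding simplicial_def pairwise_def by blast

lemma bipartition_X: "bipartition E (V - Z) X"
  unfolding bipartition_def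
proof (intro ballI impI)
  fix u v assume uv: "u \<in> V - Z" "v \<in> V - Z" "E u v"
  then have "u \<in> X \<union> Y" "v \<in> X \<union> Y"
    using V_eq W_isolated[of u v] W_isolated[of v u] sym by blast+
  then show "u \<in> X \<longleftrightarrow> v \<notin> X"
    using uv stable_parts(1,2) disjoint(1) unfolding stable_in_def by blast
qed

lemma adj_end_of_edge:
  assumes "E u v"
  shows "E x u \<or> E x v" and "E y u \<or> E y v"
proof -
  have "u \<in> V" "v \<in> V" "u \<notin> W" "v \<notin> W"
    using assms in_V in_V2 W_isolated sym by blast+
  moreover have "\<not> (u \<in> X \<and> v \<in> X)" "\<not> (u \<in> Y \<and> v \<in> Y)"
    using assms stable_parts(1,2) unfolding stable_in_def by blast+
  ultimately have "u \<in> Y \<union> Z \<or> v \<in> Y \<union> Z" "u \<in> X \<union> Z \<or> v \<in> X \<union> Z"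
    using V_eq by blast+
  then show "E x u \<or> E x v" "E y u \<or> E y v"
    using x_complete y_complete Z_complete sym by blast+
qed

lemma no_2K2: "\<not> induced_2K2 E p q r s"
proof
  assume two_K2: "induced_2K2 E p q r s"
  have "w \<noteq> x \<and> w \<noteq> y" if "w \<in> {p, q, r, s}" for w
    using that adj_end_of_edge[of p q] adj_end_of_edge[of r s] two_K2 sym
    unfolding induced_2K2_def by blast
  then have "{p, q, r, s} \<inter> Z = {}"
    using Z_neighbours two_K2 sym unfolding induced_2K2_def by blast
  then have "p \<in> X \<longleftrightarrow> q \<notin> X" "r \<in> X \<longleftrightarrow> s \<notin> X"
    using bipartition_X two_K2 two_K2_subset[OF two_K2]
    unfolding bipartition_def induced_2K2_def by blast+
  moreover have "p \<notin> W" "q \<notin> W" "r \<notin> W" "s \<notin> W"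
    using W_isolated[of p q] W_isolated[of q p] W_isolated[of r s] W_isolated[of s r]
      two_K2 two_K2_subset[OF two_K2] sym unfolding induced_2K2_def by blast+
  then have "{p, q, r, s} \<subseteq> X \<union> Y"
    using two_K2_subset[OF two_K2] \<open>{p, q, r, s} \<inter> Z = {}\<close> V_eq by blast
  moreover have "induced_2K2 E q p r s" "induced_2K2 E p q s r" "induced_2K2 E q p s r"
    using two_K2 two_K2_flip two_K2_swap by blast+
  ultimately show False
    using no_2K2_across[of p r q s] no_2K2_across[of q r p s] no_2K2_across[of p s q r]
      no_2K2_across[of q s p r] two_K2 by blast
qed

lemma small_wheel_rules: "small_wheel_rules V E"
proof
  show False if C4: "induced_C4 E p q r s" and v: "E v p" "E v q" "E v r" for p q r s v
  proof -
    have "{p, q, r} \<inter> Z = {}"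
      using simplicial_not_in_C4[OF simplicial_Z C4 C4_subset[OF C4]] by blast
    moreover have "v \<notin> Z"
      using Z_neighbours[of v p] Z_neighbours[of v q] Z_neighbours[of v r] v
        distinct_C4[OF C4]
      by auto
    moreover have "E p q" using C4 unfolding induced_C4_def by blast
    ultimately show False
      using bipartition_imp_no_triangle[OF bipartition_X, of v p q] v C4_subset[OF C4]
        in_V[OF v(1)] sym
      by blast
  qed
  show "V = {p, q, r, t, u}" if C5: "induced_C5 E p q r t u" for p q r t u
    using simplicial_not_in_C5[OF simplicial_Z C5 C5_subset[OF C5]] C5_subset[OF C5] C5
      bipartition_imp_no_C5[OF bipartition_X, of p q r t u] by blast
  show "V = {p, q, r, t, u, w}" if co_C6: "induced_co_C6 E p q r t u w" for p q r t u w
    using simplicial_not_in_co_C6[OF simplicial_Z co_C6 co_C6_subset[OF co_C6]]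
      co_C6_subset[OF co_C6] co_C6 bipartition_imp_no_triangle[OF bipartition_X, of p r u]
    unfolding induced_co_C6_def by blast
  show False if "induced_2K2 E p q r s" for p q r s
    using no_2K2 that by blast
  show "V = {p, q, r, t, u, w}" if "induced_C6 E p q r t u w" for p q r t u w
    using no_2K2 C6_imp_2K2[OF that] by blast
qed

end

subsection \<open>Two cliques joined by a matching\<close>

locale two_clique_matching = sgraph +
  fixes X :: "'a set"
  assumes same_side: "\<lbrakk>s \<in> V; t \<in> V; s \<in> X \<longleftrightarrow> t \<in> X; s \<noteq> t\<rbrakk> \<Longrightarrow> E s t"
    and partner_unique: "\<lbrakk>E s t; E s t'; s \<in> X \<longleftrightarrow> t \<notin> X; s \<in> X \<longleftrightarrow> t' \<notin> X\<rbrakk> \<Longrightarrow> t = t'"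
begin

lemma bipartition_compl: "bipartition (compl_adj V E) V X"
  using same_side unfolding bipartition_def compl_adj_def by blast

lemma C4_rule:
  assumes C4: "induced_C4 E p q r s" and v: "E v p" "E v q" "E v r"
  shows False
proof -
  have "p \<in> X \<longleftrightarrow> r \<notin> X"
    using same_side[of p r] C4 C4_subset[OF C4] unfolding induced_C4_def by blast
  then show False
    using partner_unique[of v q r] partner_unique[of v p q] partner_unique[of r q v]
      partner_unique[of p q v] v C4 irrefl sym unfolding induced_C4_def by metis
qed

lemma two_K2_rule:
  assumes two_K2: "induced_2K2 E p q r s" and v: "v \<in> V" "v \<noteq> r" "\<not> E v p" "\<not> E v q" "\<not> E v r"
  shows False
proof -
  have "v \<noteq> p" "p \<noteq> r" using two_K2 v sym unfolding induced_2K2_def by blast+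
  then show False
    using same_side[of v p] same_side[of v r] same_side[of p r] two_K2 two_K2_subset[OF two_K2] v
    unfolding induced_2K2_def by blast
qed

lemma no_C5: "\<not> induced_C5 E p q r t u"
  using sgraph.bipartition_imp_no_C5[OF sgraph_compl_adj bipartition_compl, of p r u q t]
    compl_C5_of_C5[of p q r t u] C5_subset[of p q r t u] by blast

lemma no_C6: "\<not> induced_C6 E p q r t u w"
proof
  assume C6: "induced_C6 E p q r t u w"
  then have "p \<noteq> r" "r \<noteq> u" "p \<noteq> u" using distinct_C6 by auto
  then show False
    using same_side[of p r] same_side[of r u] same_side[of p u] C6 C6_subset[OF C6] sym
    unfolding induced_C6_def by blast
qed

lemma small_wheel_rulesI:
  assumes "\<And>p q r t u w. induced_co_C6 E p q r t u w \<Longrightarrow> V = {p, q, r, t, u, w}"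
  shows "small_wheel_rules V E"
  by unfold_locales (fact C4_rule two_K2_rule assms | simp add: no_C5 no_C6)+

end

lemma (in sgraph) two_clique_matching_of_co_C6:
  assumes co_C6: "induced_co_C6 E a b c d e f" and V: "V = {a, b, c, d, e, f}"
  shows "two_clique_matching V E {a, c, e}"
proof
  show "E s t" if "s \<in> V" "t \<in> V" "s \<in> {a, c, e} \<longleftrightarrow> t \<in> {a, c, e}" "s \<noteq> t" for s t
    using that co_C6 distinct_co_C6[OF co_C6] sym unfolding V induced_co_C6_def by auto
  show "t = t'" if "E s t" "E s t'" "s \<in> {a, c, e} \<longleftrightarrow> t \<notin> {a, c, e}"
      "s \<in> {a, c, e} \<longleftrightarrow> t' \<notin> {a, c, e}" for s t t'
    using that in_V[OF that(1)] in_V2[OF that(1)] in_V2[OF that(2)] co_C6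
      distinct_co_C6[OF co_C6] sym
    unfolding V induced_co_C6_def by auto
qed

lemma (in sgraph) small_wheel_rules_of_co_C6:
  assumes co_C6: "induced_co_C6 E a b c d e f" and V: "V = {a, b, c, d, e, f}"
  shows "small_wheel_rules V E"
proof -
  interpret two_clique_matching V E "{a, c, e}" by (rule two_clique_matching_of_co_C6[OF co_C6 V])
  have "card V \<le> 6" using V distinct_co_C6[OF co_C6] by simp
  then show ?thesis
    by (intro small_wheel_rulesI co_C6_spans_if_card_le)
qed

lemma (in sgraph) small_wheel_rules_iff_compl:
  "small_wheel_rules V (compl_adj V E) \<longleftrightarrow> small_wheel_rules V E"
  using small_wheel_rules.small_wheel_rules_compl_adj[of V E]
    small_wheel_rules.small_wheel_rules_compl_adj[of V "compl_adj V E"] compl_adj_compl_adj by auto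

lemma (in sgraph) small_wheel_rules_of_C6:
  assumes "induced_C6 E a b c d e f" "V = {a, b, c, d, e, f}"
  shows "small_wheel_rules V E"
  using sgraph.small_wheel_rules_of_co_C6[OF sgraph_compl_adj
      compl_co_C6_of_C6[OF assms(1)] assms(2)]
  by (simp only: small_wheel_rules_iff_compl)

context class_C_partition
begin

lemma across_ends: "\<lbrakk>E s t; s \<in> X; t \<notin> X\<rbrakk> \<Longrightarrow> s = x1 \<and> t = y1 \<or> s = x2 \<and> t = y2"
  using across_iff in_V2 V_eq by blast

lemma two_clique_matching: "two_clique_matching V E X"
proof
  show "E s t" if "s \<in> V" "t \<in> V" "s \<in> X \<longleftrightarrow> t \<in> X" "s \<noteq> t" for s t
    using that V_eq pairwiseD(1)[OF cliques(1), of s t] pairwiseD(1)[OF cliques(2), of s t] by blast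
  show "t = t'" if "E s t" "E s t'" "s \<in> X \<longleftrightarrow> t \<notin> X" "s \<in> X \<longleftrightarrow> t' \<notin> X" for s t t'
    using that across_ends[of s t] across_ends[of s t'] across_ends[of t s] across_ends[of t' s]
      ends sym by blast
qed

sublocale two_clique_matching V E X by (rule two_clique_matching)

lemma no_co_C6: "\<not> induced_co_C6 E p q r t u w"
proof
  assume co_C6: "induced_co_C6 E p q r t u w"
  note d = distinct_co_C6[OF co_C6] and sub = co_C6_subset[OF co_C6]
  have "p \<in> X \<longleftrightarrow> q \<notin> X" "q \<in> X \<longleftrightarrow> r \<notin> X" "r \<in> X \<longleftrightarrow> t \<notin> X" "t \<in> X \<longleftrightarrow> u \<notin> X"
      "u \<in> X \<longleftrightarrow> w \<notin> X"
    using same_side[of p q] same_side[of q r] same_side[of r t] same_side[of t u] same_side[of u w]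
      co_C6 d sub unfolding induced_co_C6_def by auto
  then show False
    using across_ends[of p t] across_ends[of r w] across_ends[of u q] across_ends[of t p]
      across_ends[of w r] across_ends[of q u] co_C6 d sym unfolding induced_co_C6_def by auto
qed

lemma small_wheel_rules: "small_wheel_rules V E"
  by (rule small_wheel_rulesI) (simp add: no_co_C6)

end

lemma (in sgraph) small_wheel_rules_of_adj_basic:
  assumes "adj_basic V E"
  shows "small_wheel_rules V E"
proof -
  consider (C5) a b c d e where "induced_C5 E a b c d e" "V = {a, b, c, d, e}"
    | (C6) a b c d e f where "induced_C6 E a b c d e f" "V = {a, b, c, d, e, f}"
    | (split) "adj_split V E" | (A) "adj_class_A V E" | (B) "adj_class_B V E"
    | (C) "adj_class_C V E"
    using assms unfolding adj_basic_def by blast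
  then show ?thesis
  proof cases
    case A
    then show ?thesis
      unfolding adj_class_A_def by (elim exE) (rule class_A_partition.small_wheel_rules)
  next
    case B
    then show ?thesis
      unfolding adj_class_B_def by (elim exE) (rule class_B_partition.small_wheel_rules)
  next
    case C
    then show ?thesis
      unfolding adj_class_C_def by (elim exE) (rule class_C_partition.small_wheel_rules)
  qed (rule small_wheel_rules_of_C5 small_wheel_rules_of_C6 small_wheel_rules_of_split; assumption)+
qed

theorem (in sgraph) small_wheel_rules_iff_adj_basic:
  "small_wheel_rules V E \<longleftrightarrow> adj_basic V E \<or> adj_basic V (compl_adj V E)"
proof
  assume "adj_basic V E \<or> adj_basic V (compl_adj V E)"
  then show "small_wheel_rules V E"
  proof
    assume "adj_basic V (compl_adj V E)"
    from sgraph.small_wheel_rules_of_adj_basic[OF sgraph_compl_adj this] show ?thesis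
      by (simp only: small_wheel_rules_iff_compl)
  qed (rule small_wheel_rules_of_adj_basic)
qed (rule small_wheel_rules.adj_basic_or_compl)

section \<open>Wheels\<close>

definition induced_copy :: "nat rel \<Rightarrow> ('a \<Rightarrow> 'a \<Rightarrow> bool) \<Rightarrow> 'a list \<Rightarrow> bool" where
  "induced_copy R E xs \<longleftrightarrow> distinct xs \<and>
     (\<forall>i<length xs. \<forall>j<length xs. E (xs ! i) (xs ! j) \<longleftrightarrow> (i, j) \<in> R)"

definition hole_list :: "('a \<Rightarrow> 'a \<Rightarrow> bool) \<Rightarrow> 'a list \<Rightarrow> bool" where
  "hole_list E xs \<longleftrightarrow> 4 \<le> length xs \<and> induced_copy (parcs (cycle_graph (length xs))) E xs"

definition wheel :: "('a \<Rightarrow> 'a \<Rightarrow> bool) \<Rightarrow> 'a \<Rightarrow> 'a list \<Rightarrow> bool" where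
  "wheel E h xs \<longleftrightarrow> hole_list E xs \<and> h \<notin> set xs \<and> 3 \<le> length (filter (E h) xs)"

lemma length_eq_5_iff: "length xs = 5 \<longleftrightarrow> (\<exists>a b c d e. xs = [a, b, c, d, e])"
  by (auto simp: numeral_eq_Suc length_Suc_conv)

lemma length_eq_6_iff: "length xs = 6 \<longleftrightarrow> (\<exists>a b c d e f. xs = [a, b, c, d, e, f])"
  by (auto simp: numeral_eq_Suc length_Suc_conv)

lemma All_less_eq_list_all: "(\<forall>i<n. P i) \<longleftrightarrow> list_all P [0..<n]"
  by (auto simp: list_all_iff)

context sgraph
begin

lemma induced_copy_iff_upper:
  assumes "sym R" "irrefl R"
  shows "induced_copy R E xs \<longleftrightarrow> distinct xs \<and>
    (\<forall>j<length xs. \<forall>i<j. E (xs ! i) (xs ! j) \<longleftrightarrow> (i, j) \<in> R)"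
proof -
  have "E (xs ! i) (xs ! j) \<longleftrightarrow> (i, j) \<in> R"
    if upper: "\<forall>j<length xs. \<forall>i<j. E (xs ! i) (xs ! j) \<longleftrightarrow> (i, j) \<in> R"
      and "i < length xs" "j < length xs" for i j
    using upper[rule_format, of i j] upper[rule_format, of j i] that(2-) assms irrefl
      adj_commute[of "xs ! i" "xs ! j"]
    by (cases i j rule: linorder_cases) (auto simp: irrefl_def dest: symD)
  then show ?thesis unfolding induced_copy_def by auto
qed

lemma hole_list_iff_upper:
  "hole_list E xs \<longleftrightarrow> 4 \<le> length xs \<and> distinct xs \<and>
    (\<forall>j<length xs. \<forall>i<j. E (xs ! i) (xs ! j) \<longleftrightarrow> j = Suc i \<or> i = 0 \<and> Suc j = length xs)"
proof (cases "4 \<le> length xs")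
  case True
  have "Suc i mod n = (if Suc i = n then 0 else Suc i)" if "i < n" for i n :: nat
    using that by (simp add: mod_Suc)
  then have "(i, j) \<in> parcs (cycle_graph (length xs)) \<longleftrightarrow> j = Suc i \<or> i = 0 \<and> Suc j = length xs"
    if "j < length xs" "i < j" for i j
    using that True by (auto simp: cycle_graph_def)
  moreover have "sym (parcs (cycle_graph (length xs)))" "irrefl (parcs (cycle_graph (length xs)))"
    using True by (auto simp: cycle_graph_def sym_def irrefl_def mod_Suc)
  ultimately show ?thesis
    using True unfolding hole_list_def by (simp add: induced_copy_iff_upper)
qed (simp add: hole_list_def)

lemma hole_list_4_iff: "hole_list E [a, b, c, d] \<longleftrightarrow> induced_C4 E a b c d"
  using distinct_C4[of a b c d]
  by (auto simp: hole_list_iff_upper All_less_eq_list_all upt_rec induced_C4_def adj_commute)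

lemma hole_list_5_iff: "hole_list E [a, b, c, d, e] \<longleftrightarrow> induced_C5 E a b c d e"
  using distinct_C5[of a b c d e]
  by (auto simp: hole_list_iff_upper All_less_eq_list_all upt_rec induced_C5_def adj_commute)

lemma hole_list_6_iff: "hole_list E [a, b, c, d, e, f] \<longleftrightarrow> induced_C6 E a b c d e f"
  using distinct_C6[of a b c d e f]
  by (auto simp: hole_list_iff_upper All_less_eq_list_all upt_rec induced_C6_def adj_commute)

lemma hole_list_subset:
  assumes "hole_list E xs"
  shows "set xs \<subseteq> V"
proof
  fix v assume "v \<in> set xs"
  then obtain i where i: "i < length xs" "v = xs ! i" by (auto simp: in_set_conv_nth)
  then have "Suc i mod length xs < length xs" by (intro mod_less_divisor) linarith
  then have "E (xs ! i) (xs ! (Suc i mod length xs))"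
    using assms i(1) unfolding hole_list_def induced_copy_def cycle_graph_def by auto
  then show "v \<in> V" using in_V i(2) by simp
qed

lemma wheel_subset:
  assumes "wheel E h xs"
  shows "insert h (set xs) \<subseteq> V"
proof -
  have "filter (E h) xs \<noteq> []" using assms unfolding wheel_def by auto
  then have "h \<in> V" using in_V by (auto simp: filter_empty_conv)
  then show ?thesis using hole_list_subset[of xs] assms unfolding wheel_def by blast
qed

end

subsection \<open>Graphs without small wheels\<close>

locale small_wheel_free = sgraph +
  assumes no_small_wheel: "length xs \<le> 6 \<Longrightarrow> \<not> wheel E h xs"
begin

lemma length_filter_le_2:
  assumes "hole_list E xs" "length xs \<le> 6" "h \<notin> set xs"
  shows "length (filter (E h) xs) \<le> 2"
  using no_small_wheel[of xs h] assms unfolding wheel_def by linarith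

lemma C4_wheel_free: "C4_wheel_free V E"
proof
  fix a b c d v assume C4: "induced_C4 E a b c d" and v: "E v a" "E v b" "E v c"
  have "v \<notin> set [a, b, c, d]" using C4 v irrefl sym unfolding induced_C4_def by auto
  then have "length (filter (E v) [a, b, c, d]) \<le> 2"
    using length_filter_le_2[of "[a, b, c, d]" v] C4 hole_list_4_iff by simp
  then show False using v by (simp split: if_splits)
qed

end

lemma (in sgraph) C5_spans_if_small_wheel_free:
  assumes "small_wheel_free V E" "small_wheel_free V (compl_adj V E)"
    and C5: "induced_C5 E a b c d e"
  shows "V = {a, b, c, d, e}"
proof (rule ccontr)
  interpret small_wheel_free V E by fact
  interpret compl: small_wheel_free V "compl_adj V E" by fact
  let ?S = "{a, b, c, d, e}"
  assume "V \<noteq> ?S"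
  then obtain v where v: "v \<in> V" "v \<notin> ?S" using C5_subset[OF C5] by blast
  have "length (filter (E v) [a, b, c, d, e]) \<le> 2"
    using length_filter_le_2[of "[a, b, c, d, e]" v] C5 v hole_list_5_iff by simp
  moreover have "length (filter (compl_adj V E v) [a, c, e, b, d]) \<le> 2"
    using compl.length_filter_le_2[of "[a, c, e, b, d]" v] compl_C5_of_C5[OF C5] v
      compl.hole_list_5_iff by simp
  moreover have "compl_adj V E v u \<longleftrightarrow> \<not> E v u" if "u \<in> ?S" for u
    using C5_subset[OF C5] v that unfolding compl_adj_def by blast
  ultimately show False by (auto split: if_splits)
qed

text \<open>
  A further vertex has two neighbours in each of the three induced \<open>2K\<^sub>2\<close> formed by opposite edges,
  and every vertex of the 6-hole lies in two of these.
\<close>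

lemma (in sgraph) C6_spans_if_small_wheel_free:
  assumes "small_wheel_free V E" "small_wheel_free V (compl_adj V E)"
    and C6: "induced_C6 E a b c d e f"
  shows "V = {a, b, c, d, e, f}"
proof (rule ccontr)
  interpret small_wheel_free V E by fact
  interpret compl: small_wheel_free V "compl_adj V E" by fact
  interpret compl: C4_wheel_free V "compl_adj V E" by (rule compl.C4_wheel_free)
  note two_K2_rule = compl.compl_two_K2_rule[unfolded compl_adj_compl_adj]
  assume "V \<noteq> {a, b, c, d, e, f}"
  then obtain v where v: "v \<in> V" "v \<notin> {a, b, c, d, e, f}" using C6_subset[OF C6] by blast
  define n where "n u = (of_bool (E v u) :: nat)" for u
  have two_neighbours: "2 \<le> n p + n q + n r + n s"
    if two_K2: "induced_2K2 E p q r s" and out: "v \<notin> {p, q, r, s}" for p q r s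
    using two_K2_rule[OF two_K2 v(1)] two_K2_rule[of p q s r v]
      two_K2_rule[OF two_K2_swap[OF two_K2] v(1)]
      two_K2_rule[of r s q p v] two_K2 out v(1) sym unfolding induced_2K2_def n_def by auto
  have "induced_2K2 E a b d e" "induced_2K2 E b c e f" "induced_2K2 E c d f a"
    using C6 sym unfolding induced_defs by blast+
  from this[THEN two_neighbours]
  have "2 \<le> n a + n b + n d + n e" "2 \<le> n b + n c + n e + n f" "2 \<le> n c + n d + n f + n a"
    using v(2) by simp_all
  moreover have "length (filter (E v) [a, b, c, d, e, f]) \<le> 2"
    using length_filter_le_2[of "[a, b, c, d, e, f]" v] C6 v hole_list_6_iff by simp
  then have "n a + n b + n c + n d + n e + n f \<le> 2"
    by (auto simp: n_def split: if_splits)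
  ultimately show False by linarith
qed

lemma (in sgraph) small_wheel_rules_if_small_wheel_free:
  assumes E: "small_wheel_free V E" and compl: "small_wheel_free V (compl_adj V E)"
  shows "small_wheel_rules V E"
proof -
  interpret C4_wheel_free V E by (rule small_wheel_free.C4_wheel_free[OF E])
  interpret compl: C4_wheel_free V "compl_adj V E"
    by (rule small_wheel_free.C4_wheel_free[OF compl])
  show ?thesis
  proof
    show False
      if "induced_2K2 E p q r s" "v \<in> V" "v \<noteq> r" "\<not> E v p" "\<not> E v q" "\<not> E v r" for p q r s v
      using compl.compl_two_K2_rule[of p q r s v] that unfolding compl_adj_compl_adj by blast
    show "V = {a, b, c, d, e}" if "induced_C5 E a b c d e" for a b c d e
      by (rule C5_spans_if_small_wheel_free[OF E compl that])
    show "V = {a, b, c, d, e, f}" if "induced_C6 E a b c d e f" for a b c d e f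
      by (rule C6_spans_if_small_wheel_free[OF E compl that])
    show "V = {a, b, c, d, e, f}" if "induced_co_C6 E a b c d e f" for a b c d e f
      using compl.C6_spans_if_small_wheel_free[OF compl _ compl_C6_of_co_C6[OF that]] E
      unfolding compl_adj_compl_adj by blast
  qed
qed

subsection \<open>The rules exclude all wheels\<close>

context small_wheel_rules
begin

lemma C4_length_filter_le:
  assumes "induced_C4 E a b c d"
  shows "length (filter (E v) [a, b, c, d]) \<le> 2"
  using C4_rule[OF assms, of v] C4_rule[OF C4_rotate[OF assms], of v]
    C4_rule[OF C4_rotate[OF C4_rotate[OF assms]], of v] C4_rule[OF C4_reflect[OF assms], of v]
  by auto

lemma length_hole_list_le:
  assumes "hole_list E xs"
  shows "length xs \<le> 6"
proof (rule ccontr)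
  let ?k = "length xs"
  assume long: "\<not> ?k \<le> 6"
  then have "xs \<noteq> []" by auto
  have adj: "E (xs ! i) (xs ! j) \<longleftrightarrow> j = Suc i mod ?k \<or> i = Suc j mod ?k" if "i < ?k" "j < ?k" for i j
    using assms that unfolding hole_list_def induced_copy_def cycle_graph_def by auto
  have "Suc i mod ?k = Suc i" if "i < 6" for i using that long by simp
  moreover have "7 mod ?k = 0 \<or> 7 mod ?k = 7" using long by (cases "?k = 7") auto
  ultimately have "induced_2K2 E (xs ! 3) (xs ! 4) (xs ! 1) (xs ! 0)"
      "\<not> E (xs ! 6) (xs ! 3)" "\<not> E (xs ! 6) (xs ! 4)" "\<not> E (xs ! 6) (xs ! 1)"
    using long \<open>xs \<noteq> []\<close> by (auto simp: induced_2K2_def adj)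
  moreover have "xs ! 6 \<noteq> xs ! 1"
    using assms long unfolding hole_list_def induced_copy_def by (simp add: nth_eq_iff_index_eq)
  moreover have "xs ! 6 \<in> V"
    using hole_list_subset[OF assms] long by (meson linorder_not_le nth_mem subsetD)
  ultimately show False using two_K2_rule by blast
qed

lemma no_wheel: "\<not> wheel E h xs"
proof
  assume wheel: "wheel E h xs"
  have "h \<in> V" using wheel_subset[OF wheel] by blast
  have hole: "hole_list E xs" and h: "h \<notin> set xs" and deg: "3 \<le> length (filter (E h) xs)"
    using wheel unfolding wheel_def by blast+
  have "4 \<le> length xs" "length xs \<le> 6"
    using hole length_hole_list_le unfolding hole_list_def by blast+
  then consider (C4) "length xs = 4" | (C5) "length xs = 5" | (C6) "length xs = 6" by linarith
  then show False
  proof cases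
    case C4
    then obtain a b c d where "xs = [a, b, c, d]" by (auto simp: numeral_eq_Suc length_Suc_conv)
    then show False
      using C4_length_filter_le[of a b c d h] hole hole_list_4_iff deg by simp
  next
    case C5
    then obtain a b c d e where "xs = [a, b, c, d, e]" by (auto simp: length_eq_5_iff)
    then show False
      using C5_spans[of a b c d e] hole hole_list_5_iff h \<open>h \<in> V\<close> by simp
  next
    case C6
    then obtain a b c d e f where "xs = [a, b, c, d, e, f]" by (auto simp: length_eq_6_iff)
    then show False
      using C6_spans[of a b c d e f] hole hole_list_6_iff h \<open>h \<in> V\<close> by simp
  qed
qed

end

lemma (in sgraph) small_wheel_rules_iff_no_small_wheel:
  "small_wheel_rules V E \<longleftrightarrow>
    (\<forall>h xs. length xs \<le> 6 \<longrightarrow> \<not> wheel E h xs \<and> \<not> wheel (compl_adj V E) h xs)"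
proof
  assume rules: "small_wheel_rules V E"
  note compl_rules = small_wheel_rules.small_wheel_rules_compl_adj[OF rules]
  show "\<forall>h xs. length xs \<le> 6 \<longrightarrow> \<not> wheel E h xs \<and> \<not> wheel (compl_adj V E) h xs"
    using small_wheel_rules.no_wheel[OF rules] small_wheel_rules.no_wheel[OF compl_rules] by blast
next
  assume "\<forall>h xs. length xs \<le> 6 \<longrightarrow> \<not> wheel E h xs \<and> \<not> wheel (compl_adj V E) h xs"
  then have "small_wheel_free V E" "small_wheel_free V (compl_adj V E)"
    using sgraph_axioms sgraph_compl_adj
    unfolding small_wheel_free_def small_wheel_free_axioms_def by blast+
  then show "small_wheel_rules V E" by (rule small_wheel_rules_if_small_wheel_free)
qed

lemma (in sgraph) small_wheel_rules_iff_no_wheel: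
  "small_wheel_rules V E \<longleftrightarrow> (\<forall>h xs. \<not> wheel E h xs \<and> \<not> wheel (compl_adj V E) h xs)"
proof
  assume rules: "small_wheel_rules V E"
  note compl_rules = small_wheel_rules.small_wheel_rules_compl_adj[OF rules]
  show "\<forall>h xs. \<not> wheel E h xs \<and> \<not> wheel (compl_adj V E) h xs"
    using small_wheel_rules.no_wheel[OF rules] small_wheel_rules.no_wheel[OF compl_rules] by blast
qed (simp add: small_wheel_rules_iff_no_small_wheel)

section \<open>Transfer to digraphs\<close>

lemma sgraph_of_graph:
  assumes "graph G"
  shows "sgraph (verts G) (dominates G)"
proof -
  interpret graph G by fact
  show ?thesis
    by unfold_locales (auto intro: graph_symmetric dest: adj_not_same adj_in_verts)
qed

lemma wf_digraph_of_graph: "graph G \<Longrightarrow> wf_digraph G"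
  by (simp add: graph_def digraph_def fin_digraph_def)

lemma dominates_induce_iff: "u \<rightarrow>\<^bsub>G \<restriction> S\<^esub> v \<longleftrightarrow> u \<in> S \<and> v \<in> S \<and> u \<rightarrow>\<^bsub>G\<^esub> v"
  by (auto simp: arcs_ends_conv)

lemma induced_subgraph_iff:
  assumes "wf_digraph G"
  shows "induced_subgraph H G \<longleftrightarrow> (\<exists>S \<subseteq> verts G. H = G \<restriction> S)"
proof
  assume H: "induced_subgraph H G"
  then have "compatible G H" by auto
  then have "H = G \<restriction> verts H"
    using H by (intro pre_digraph.equality) (auto simp: compatible_def)
  moreover have "verts H \<subseteq> verts G" using H by auto
  ultimately show "\<exists>S \<subseteq> verts G. H = G \<restriction> S" by blast
next
  assume "\<exists>S \<subseteq> verts G. H = G \<restriction> S"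
  then show "induced_subgraph H G"
    using wf_digraph.induced_induce[OF assms] by blast
qed

lemma free_of_iff: "wf_digraph G \<Longrightarrow> free_of F G \<longleftrightarrow> (\<forall>S \<subseteq> verts G. \<not> F (G \<restriction> S))"
  unfolding free_of_def by (auto simp: induced_subgraph_iff)

lemma graph_induce:
  assumes "graph G" "S \<subseteq> verts G"
  shows "graph (G \<restriction> S)"
proof -
  interpret graph G by fact
  have "induced_subgraph (G \<restriction> S) G" using assms(2) by (rule induced_induce)
  then have "digraph (G \<restriction> S)" "sym_digraph (G \<restriction> S)"
    using digraphI_induced induced_graph_imp_graph by blast+
  then show ?thesis
    by (simp add: graph_def pseudo_graph_def digraph_def)
qed

lemma induce_induce: "T \<subseteq> S \<Longrightarrow> (G \<restriction> S) \<restriction> T = G \<restriction> T"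
  by (intro pre_digraph.equality) auto

lemma verts_complement: "verts (complement G) = verts G"
  by (simp add: complement_def)

lemma dominates_complement: "dominates (complement G) = compl_adj (verts G) (dominates G)"
  by (auto simp: complement_def compl_adj_def fun_eq_iff)

lemma graph_complement:
  assumes "graph G"
  shows "graph (complement G)"
proof -
  interpret graph G by fact
  let ?H = "\<lparr>pverts = verts G,
    parcs = {(u, v). u \<in> verts G \<and> v \<in> verts G \<and> u \<noteq> v \<and> \<not> u \<rightarrow>\<^bsub>G\<^esub> v}\<rparr>"
  have "pair_graph ?H"
  proof
    show "finite (parcs ?H)"
      by (rule finite_subset[of _ "verts G \<times> verts G"]) auto
    show "symmetric ?H"
      using graph_symmetric by (auto simp: symmetric_def intro: symI)
  qed auto
  then show ?thesis
    unfolding complement_def by (rule pair_graph.pair_graphD_graph)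
qed

lemma complement_induce:
  assumes "S \<subseteq> verts G"
  shows "complement (G \<restriction> S) = complement G \<restriction> S"
  using assms
  by (intro pre_digraph.equality) (auto simp: complement_def dominates_induce_iff)

subsection \<open>Isomorphisms onto cycles and paths\<close>

lemma digraph_iso_with_projE:
  assumes "graph G" "digraph_iso G (with_proj H)"
  obtains f where "bij_betw f (verts G) (pverts H)"
    and "\<And>u v. \<lbrakk>u \<in> verts G; v \<in> verts G\<rbrakk> \<Longrightarrow> u \<rightarrow>\<^bsub>G\<^esub> v \<longleftrightarrow> (f u, f v) \<in> parcs H"
proof -
  interpret graph G by fact
  obtain h where h: "digraph_isomorphism h" "with_proj H = app_iso h G"
    using assms(2) unfolding digraph_iso_def by blast
  have inj: "inj_on (iso_verts h) (verts G)"
    using h(1) by (rule digraph_isomorphism_inj_on_verts)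
  have "pverts H = iso_verts h ` verts G"
    using arg_cong[OF h(2), of verts] by simp
  moreover have parcs: "parcs H = (\<lambda>(u, v). (iso_verts h u, iso_verts h v)) ` arcs_ends G"
    using arg_cong[OF h(2), of arcs_ends] arcs_ends_app_iso_eq[OF h(1)] by simp
  moreover have "u \<rightarrow>\<^bsub>G\<^esub> v \<longleftrightarrow> (iso_verts h u, iso_verts h v) \<in> parcs H"
    if "u \<in> verts G" "v \<in> verts G" for u v
  proof
    assume "(iso_verts h u, iso_verts h v) \<in> parcs H"
    then obtain a b where "a \<rightarrow>\<^bsub>G\<^esub> b" "iso_verts h u = iso_verts h a" "iso_verts h v = iso_verts h b"
      unfolding parcs by auto
    then show "u \<rightarrow>\<^bsub>G\<^esub> v"
      using that inj by (metis adj_in_verts inj_onD)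
  qed (auto simp: parcs)
  ultimately show thesis
    using inj by (intro that[of "iso_verts h"]) (auto simp: bij_betw_def)
qed

lemma digraph_iso_with_projI:
  assumes "graph G" and H: "pair_wf_digraph H" and f: "bij_betw f (verts G) (pverts H)"
    and adj: "\<And>u v. \<lbrakk>u \<in> verts G; v \<in> verts G\<rbrakk> \<Longrightarrow> u \<rightarrow>\<^bsub>G\<^esub> v \<longleftrightarrow> (f u, f v) \<in> parcs H"
  shows "digraph_iso G (with_proj H)"
proof -
  interpret graph G by fact
  let ?h = "\<lparr>iso_verts = f, iso_arcs = (\<lambda>e. (f (tail G e), f (head G e))),
    iso_head = snd, iso_tail = fst\<rparr>"
  have inj: "inj_on f (verts G)" using f by (simp add: bij_betw_def)
  have iso: "digraph_isomorphism ?h"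
    unfolding digraph_isomorphism_def
  proof (intro conjI ballI)
    show "wf_digraph G" by unfold_locales
    show "inj_on (iso_arcs ?h) (arcs G)"
      using inj no_multi_arcs by (auto simp: inj_on_def arc_to_ends_def)
  qed (use inj in auto)
  have "(\<lambda>e. (f (tail G e), f (head G e))) ` arcs G = parcs H"
  proof (intro equalityI subsetI)
    fix e assume "e \<in> (\<lambda>e. (f (tail G e), f (head G e))) ` arcs G"
    then show "e \<in> parcs H"
      using adj[OF wellformed] by (auto simp: arcs_ends_conv)
  next
    fix e assume e: "e \<in> parcs H"
    then have "fst e \<in> f ` verts G" "snd e \<in> f ` verts G"
      using f pair_wf_digraph.in_arcsD1[OF H] pair_wf_digraph.in_arcsD2[OF H]
      by (auto simp: bij_betw_def) (metis prod.collapse)+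
    then obtain u v where uv: "u \<in> verts G" "v \<in> verts G" "e = (f u, f v)"
      by (metis imageE prod.collapse)
    then have "u \<rightarrow>\<^bsub>G\<^esub> v" using adj e by blast
    then show "e \<in> (\<lambda>e. (f (tail G e), f (head G e))) ` arcs G"
      using uv by (auto simp: arcs_ends_conv)
  qed
  then have "with_proj H = app_iso ?h G"
    using f by (intro pre_digraph.equality) (auto simp: bij_betw_def with_proj_def)
  with iso show ?thesis unfolding digraph_iso_def by blast
qed

lemma digraph_iso_iff_induced_copy:
  assumes "graph G" "pair_wf_digraph H" and H: "pverts H = {..<k}"
  shows "digraph_iso G (with_proj H) \<longleftrightarrow>
    (\<exists>xs. length xs = k \<and> set xs = verts G \<and> induced_copy (parcs H) (dominates G) xs)"
proof
  assume "digraph_iso G (with_proj H)"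
  then obtain f where f: "bij_betw f (verts G) {..<k}"
    and adj: "\<And>u v. \<lbrakk>u \<in> verts G; v \<in> verts G\<rbrakk> \<Longrightarrow> u \<rightarrow>\<^bsub>G\<^esub> v \<longleftrightarrow> (f u, f v) \<in> parcs H"
    using digraph_iso_with_projE[OF assms(1)] H by metis
  let ?g = "inv_into (verts G) f"
  have g: "bij_betw ?g {..<k} (verts G)" by (rule bij_betw_inv_into[OF f])
  have "?g i \<in> verts G" "f (?g i) = i" if "i < k" for i
    using that g bij_betw_inv_into_right[OF f] by (auto simp: bij_betw_def)
  then have "induced_copy (parcs H) (dominates G) (map ?g [0..<k])"
    using g adj by (auto simp: induced_copy_def bij_betw_def distinct_map atLeast0LessThan)
  then show "\<exists>xs. length xs = k \<and> set xs = verts G \<and> induced_copy (parcs H) (dominates G) xs"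
    using g by (intro exI[of _ "map ?g [0..<k]"]) (auto simp: bij_betw_def atLeast0LessThan)
next
  assume "\<exists>xs. length xs = k \<and> set xs = verts G \<and> induced_copy (parcs H) (dominates G) xs"
  then obtain xs where xs: "length xs = k" "set xs = verts G" "distinct xs"
    and adj: "\<And>i j. \<lbrakk>i < k; j < k\<rbrakk> \<Longrightarrow> xs ! i \<rightarrow>\<^bsub>G\<^esub> xs ! j \<longleftrightarrow> (i, j) \<in> parcs H"
    unfolding induced_copy_def by blast
  let ?f = "inv_into {..<k} ((!) xs)"
  have nth: "bij_betw ((!) xs) {..<k} (verts G)"
    using bij_betw_nth[OF xs(3), of "{..<k}" "verts G"] xs by simp
  have f: "bij_betw ?f (verts G) {..<k}" by (rule bij_betw_inv_into[OF nth])
  have "?f u < k" "xs ! ?f u = u" if "u \<in> verts G" for u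
    using that f bij_betw_inv_into_right[OF nth that] by (auto simp: bij_betw_def)
  then show "digraph_iso G (with_proj H)"
    using adj f H by (intro digraph_iso_with_projI[OF assms(1,2), of ?f]) (simp, metis)
qed

lemma induced_copy_cong:
  "(\<And>u v. \<lbrakk>u \<in> set xs; v \<in> set xs\<rbrakk> \<Longrightarrow> E u v \<longleftrightarrow> E' u v) \<Longrightarrow>
    induced_copy R E xs \<longleftrightarrow> induced_copy R E' xs"
  unfolding induced_copy_def by simp

lemma is_hole_iff:
  assumes "graph G"
  shows "is_hole k G \<longleftrightarrow>
    (\<exists>xs. length xs = k \<and> set xs = verts G \<and> hole_list (dominates G) xs)"
proof -
  have "pair_wf_digraph (cycle_graph k)" "pverts (cycle_graph k) = {..<k}"
    by unfold_locales (auto simp: cycle_graph_def)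
  from digraph_iso_iff_induced_copy[OF assms this] show ?thesis
    unfolding is_hole_def hole_list_def using assms by auto
qed

lemma is_hole_induce_iff:
  assumes "graph G" "S \<subseteq> verts G"
  shows "is_hole k (G \<restriction> S) \<longleftrightarrow>
    (\<exists>xs. length xs = k \<and> set xs = S \<and> hole_list (dominates G) xs)"
proof -
  have "hole_list (dominates (G \<restriction> S)) xs \<longleftrightarrow> hole_list (dominates G) xs" if "set xs = S" for xs
    unfolding hole_list_def using that
    by (intro conj_cong refl induced_copy_cong) (simp add: dominates_induce_iff)
  then show ?thesis
    unfolding is_hole_iff[OF graph_induce[OF assms]] by auto
qed

lemma is_hole_5_iff:
  assumes "graph G"
  shows "is_hole 5 G \<longleftrightarrow>
    (\<exists>a b c d e. induced_C5 (dominates G) a b c d e \<and> verts G = {a, b, c, d, e})"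
proof -
  interpret sgraph "verts G" "dominates G" using assms by (rule sgraph_of_graph)
  have "is_hole 5 G \<longleftrightarrow>
    (\<exists>a b c d e. hole_list (dominates G) [a, b, c, d, e] \<and> verts G = set [a, b, c, d, e])"
    unfolding is_hole_iff[OF assms] length_eq_5_iff by metis
  then show ?thesis by (simp add: hole_list_5_iff)
qed

lemma is_hole_6_iff:
  assumes "graph G"
  shows "is_hole 6 G \<longleftrightarrow>
    (\<exists>a b c d e f. induced_C6 (dominates G) a b c d e f \<and> verts G = {a, b, c, d, e, f})"
proof -
  interpret sgraph "verts G" "dominates G" using assms by (rule sgraph_of_graph)
  have "is_hole 6 G \<longleftrightarrow>
    (\<exists>a b c d e f. hole_list (dominates G) [a, b, c, d, e, f] \<and> verts G = set [a, b, c, d, e, f])"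
    unfolding is_hole_iff[OF assms] length_eq_6_iff by metis
  then show ?thesis by (simp add: hole_list_6_iff)
qed

subsection \<open>Wheels and antiwheels\<close>

lemma is_wheel_induce_iff:
  assumes "graph G" "S \<subseteq> verts G"
  shows "is_wheel (G \<restriction> S) \<longleftrightarrow>
    (\<exists>h xs. wheel (dominates G) h xs \<and> S = insert h (set xs))"
proof -
  have hub: "(\<exists>k. is_hole k ((G \<restriction> S) \<restriction> (S - {h}))) \<and> 3 \<le> card {v \<in> S - {h}. h \<rightarrow>\<^bsub>G \<restriction> S\<^esub> v} \<longleftrightarrow>
    (\<exists>xs. wheel (dominates G) h xs \<and> S = insert h (set xs))" if "h \<in> S" for h
  proof -
    have induce: "(G \<restriction> S) \<restriction> (S - {h}) = G \<restriction> (S - {h})"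
      by (rule induce_induce) blast
    have "S - {h} \<subseteq> verts G" using assms(2) by blast
    from is_hole_induce_iff[OF assms(1) this]
    have hole: "(\<exists>k. is_hole k ((G \<restriction> S) \<restriction> (S - {h}))) \<longleftrightarrow>
      (\<exists>xs. set xs = S - {h} \<and> hole_list (dominates G) xs)"
      unfolding induce by blast
    define N where "N = {v \<in> S - {h}. h \<rightarrow>\<^bsub>G \<restriction> S\<^esub> v}"
    have card: "card N = length (filter (dominates G h) xs)"
      if "set xs = S - {h}" "hole_list (dominates G) xs" for xs
    proof -
      have "N = set (filter (dominates G h) xs)"
        unfolding N_def set_filter that(1) dominates_induce_iff using \<open>h \<in> S\<close> by blast
      then show ?thesis
        using that(2) by (simp only: distinct_card distinct_filter hole_list_def induced_copy_def)
    qed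
    have "set xs = S - {h} \<longleftrightarrow> h \<notin> set xs \<and> S = insert h (set xs)" for xs
      using \<open>h \<in> S\<close> by blast
    then have "wheel (dominates G) h xs \<and> S = insert h (set xs) \<longleftrightarrow>
        (set xs = S - {h} \<and> hole_list (dominates G) xs) \<and> 3 \<le> card N" for xs
      using card[of xs] unfolding wheel_def by metis
    then show ?thesis unfolding hole N_def by blast
  qed
  have "is_wheel (G \<restriction> S) \<longleftrightarrow>
    (\<exists>h\<in>S. \<exists>xs. wheel (dominates G) h xs \<and> S = insert h (set xs))"
    unfolding is_wheel_def using graph_induce[OF assms] hub by simp
  then show ?thesis by blast
qed

lemma free_of_wheel_antiwheel_iff:
  assumes "graph G"
  shows "free_of (\<lambda>H. P (card (verts H)) \<and> (is_wheel H \<or> is_antiwheel H)) G \<longleftrightarrow>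
    (\<forall>h xs. P (Suc (length xs)) \<longrightarrow>
       \<not> wheel (dominates G) h xs \<and> \<not> wheel (compl_adj (verts G) (dominates G)) h xs)"
proof -
  interpret sgraph "verts G" "dominates G" using assms by (rule sgraph_of_graph)
  interpret compl: sgraph "verts G" "compl_adj (verts G) (dominates G)" by (rule sgraph_compl_adj)
  let ?wheel = "\<lambda>h xs. wheel (dominates G) h xs \<or> wheel (compl_adj (verts G) (dominates G)) h xs"
  have "is_wheel (G \<restriction> S) \<or> is_antiwheel (G \<restriction> S) \<longleftrightarrow> (\<exists>h xs. ?wheel h xs \<and> S = insert h (set xs))"
    if S: "S \<subseteq> verts G" for S
  proof -
    have "is_antiwheel (G \<restriction> S) \<longleftrightarrow>
      (\<exists>h xs. wheel (compl_adj (verts G) (dominates G)) h xs \<and> S = insert h (set xs))"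
      using is_wheel_induce_iff[OF graph_complement[OF assms], of S] graph_induce[OF assms S] S
      by (simp add: is_antiwheel_def complement_induce[OF S] verts_complement dominates_complement)
    then show ?thesis
      unfolding is_wheel_induce_iff[OF assms S] by blast
  qed
  moreover have "insert h (set xs) \<subseteq> verts G" if "?wheel h xs" for h xs
    using that wheel_subset compl.wheel_subset by blast
  moreover have "card (insert h (set xs)) = Suc (length xs)" if "?wheel h xs" for h xs
    using that by (auto simp: wheel_def hole_list_def induced_copy_def distinct_card)
  ultimately show ?thesis
    unfolding free_of_iff[OF wf_digraph_of_graph[OF assms]] induce_subgraph_verts by metis
qed

subsection \<open>The basic classes\<close>

lemma split_graph_iff:
  assumes "graph G"
  shows "split_graph G \<longleftrightarrow> adj_split (verts G) (dominates G)"
proof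
  assume "split_graph G"
  then obtain S K where "verts G = S \<union> K" "S \<inter> K = {}" "stable G S" "clique G K"
    unfolding split_graph_def by blast
  moreover from this have "verts G - K = S" by blast
  ultimately show "adj_split (verts G) (dominates G)"
    unfolding adj_split_def stable_def clique_def stable_in_def pairwise_def by blast
next
  assume "adj_split (verts G) (dominates G)"
  then obtain K where "K \<subseteq> verts G" "clique G K" "stable G (verts G - K)"
    unfolding adj_split_def stable_def clique_def stable_in_def pairwise_def by blast
  then show "split_graph G"
    unfolding split_graph_def using assms
    by (intro conjI exI[of _ "verts G - K"] exI[of _ K]) auto
qed

lemma arcs_ends_induce_eq_iff:
  assumes "R \<subseteq> S \<times> S"
  shows "arcs_ends (G \<restriction> S) = R \<longleftrightarrow> (\<forall>u\<in>S. \<forall>v\<in>S. u \<rightarrow>\<^bsub>G\<^esub> v \<longleftrightarrow> (u, v) \<in> R)"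
  using assms dominates_induce_iff[of _ _ G S] by (auto simp: set_eq_iff)

lemma arcs_ends_induce_C4_iff:
  assumes "graph G" "distinct [a, b, c, d]"
  shows "arcs_ends (G \<restriction> {a, b, c, d}) = symcl {(a, b), (b, c), (c, d), (d, a)} \<longleftrightarrow>
    induced_C4 (dominates G) a b c d"
proof -
  interpret sgraph "verts G" "dominates G" using assms(1) by (rule sgraph_of_graph)
  have "symcl {(a, b), (b, c), (c, d), (d, a)} \<subseteq> {a, b, c, d} \<times> {a, b, c, d}"
    by (auto simp: symcl_def)
  from arcs_ends_induce_eq_iff[OF this, of G] show ?thesis
    using assms(2) by (auto simp: induced_C4_def symcl_def adj_commute irrefl)
qed

lemma card_filter_doubleton_le_1_iff:
  assumes "c \<noteq> d"
  shows "card {v \<in> {c, d}. P v} \<le> 1 \<longleftrightarrow> \<not> (P c \<and> P d)"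
proof -
  have "{v \<in> {c, d}. P v} = (if P c then {c} else {}) \<union> (if P d then {d} else {})" by auto
  then show ?thesis using assms by auto
qed

lemma class_A_partition_iff:
  assumes "graph G"
  shows "class_A_partition (verts G) (dominates G) a b c d e X \<longleftrightarrow>
    distinct [a, b, c, d, e] \<and> verts G = {a, b, c, d, e} \<union> X \<and> {a, b, c, d, e} \<inter> X = {} \<and>
    arcs_ends (G \<restriction> {a, b, c, d}) = symcl {(a,b), (b,c), (c,d), (d,a)} \<and>
    X \<noteq> {} \<and> clique G X \<and> complete_to G X {c, d} \<and> anticomplete_to G X {a, b} \<and>
    complete_to G {e} X \<and> anticomplete_to G {e} {a, b} \<and>
    card {v \<in> {c, d}. e \<rightarrow>\<^bsub>G\<^esub> v} \<le> 1"
proof (cases "distinct [a, b, c, d, e] \<and> verts G = {a, b, c, d, e} \<union> X")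
  case True
  interpret sgraph "verts G" "dominates G" using assms by (rule sgraph_of_graph)
  have "c \<noteq> d" "distinct [a, b, c, d]" and V_eq: "verts G = {a, b, c, d, e} \<union> X"
    using True by simp_all
  have clique_iff: "clique G X \<longleftrightarrow> pairwise (dominates G) X"
    using V_eq by (auto simp: clique_def pairwise_def)
  show ?thesis
    unfolding class_A_partition_def class_A_partition_axioms_def
      card_filter_doubleton_le_1_iff[OF \<open>c \<noteq> d\<close>]
      arcs_ends_induce_C4_iff[OF assms \<open>distinct [a, b, c, d]\<close>]
      complete_to_def anticomplete_to_def clique_iff
    using True sgraph_axioms by (simp add: conj_ac flip: Ball_def)
next
  case False
  then show ?thesis
    unfolding class_A_partition_def class_A_partition_axioms_def by argo
qed

lemma class_A_iff:
  assumes "graph G"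
  shows "class_A G \<longleftrightarrow> adj_class_A (verts G) (dominates G)"
  unfolding class_A_def adj_class_A_def class_A_partition_iff[OF assms] using assms by simp

lemma card_ge_2_iff_not_singleton:
  assumes "finite A" "a \<in> A"
  shows "2 \<le> card A \<longleftrightarrow> A \<noteq> {a}"
proof -
  have "1 < card A \<longleftrightarrow> card A \<noteq> 1" using card_gt_0_iff[of A] assms by fastforce
  also have "\<dots> \<longleftrightarrow> A \<noteq> {a}" using assms(2) by (auto simp: card_1_singleton_iff)
  finally show ?thesis by linarith
qed

lemma adj_iff_edge_between:
  assumes "X \<inter> Y = {}" "s \<in> X" "t \<in> Y"
  shows "s \<rightarrow>\<^bsub>G\<^esub> t \<longleftrightarrow> {s, t} \<in> edges_between G X Y"
  using assms unfolding edges_between_def by (auto simp: doubleton_eq_iff)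

lemma edges_between_matching_iff:
  assumes disjoint: "X \<inter> Y = {}"
  shows "pairwise disjnt (edges_between G X Y) \<and> card (edges_between G X Y) = 2 \<longleftrightarrow>
    (\<exists>x1 x2 y1 y2. x1 \<in> X \<and> x2 \<in> X \<and> x1 \<noteq> x2 \<and> y1 \<in> Y \<and> y2 \<in> Y \<and> y1 \<noteq> y2 \<and>
      (\<forall>s\<in>X. \<forall>t\<in>Y. s \<rightarrow>\<^bsub>G\<^esub> t \<longleftrightarrow> s = x1 \<and> t = y1 \<or> s = x2 \<and> t = y2))"
    (is "?L \<longleftrightarrow> (\<exists>x1 x2 y1 y2. ?R x1 x2 y1 y2)")
proof
  assume ?L
  then obtain e1 e2 where e: "edges_between G X Y = {e1, e2}" "e1 \<noteq> e2" "disjnt e1 e2"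
    by (auto simp: card_2_iff pairwise_def)
  then have "e1 \<in> edges_between G X Y" "e2 \<in> edges_between G X Y" by auto
  then obtain x1 y1 x2 y2 where xy: "e1 = {x1, y1}" "x1 \<in> X" "y1 \<in> Y"
      "e2 = {x2, y2}" "x2 \<in> X" "y2 \<in> Y"
    unfolding edges_between_def by blast
  have "x1 \<noteq> x2" "y1 \<noteq> y2" using e(3) xy by (auto simp: disjnt_def)
  moreover have "s \<rightarrow>\<^bsub>G\<^esub> t \<longleftrightarrow> s = x1 \<and> t = y1 \<or> s = x2 \<and> t = y2" if "s \<in> X" "t \<in> Y" for s t
    unfolding adj_iff_edge_between[OF disjoint that] e using that disjoint xy
    by (auto simp: doubleton_eq_iff)
  ultimately show "\<exists>x1 x2 y1 y2. ?R x1 x2 y1 y2"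
    using xy by blast
next
  assume "\<exists>x1 x2 y1 y2. ?R x1 x2 y1 y2"
  then obtain x1 x2 y1 y2 where xy: "x1 \<in> X" "x2 \<in> X" "x1 \<noteq> x2" "y1 \<in> Y" "y2 \<in> Y" "y1 \<noteq> y2"
    and adj: "\<And>s t. \<lbrakk>s \<in> X; t \<in> Y\<rbrakk> \<Longrightarrow> s \<rightarrow>\<^bsub>G\<^esub> t \<longleftrightarrow> s = x1 \<and> t = y1 \<or> s = x2 \<and> t = y2"
    by blast
  have "edges_between G X Y = {{x1, y1}, {x2, y2}}"
    using adj xy unfolding edges_between_def by blast
  moreover have "disjnt {x1, y1} {x2, y2}" using xy disjoint by (auto simp: disjnt_def)
  moreover have "{x1, y1} \<noteq> {x2, y2}" using xy disjoint by (auto simp: doubleton_eq_iff)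
  ultimately show ?L
    by (auto simp: pairwise_insert disjnt_sym)
qed

lemma class_C_iff:
  assumes "graph G"
  shows "class_C G \<longleftrightarrow> adj_class_C (verts G) (dominates G)"
proof -
  interpret sgraph "verts G" "dominates G" using assms(1) by (rule sgraph_of_graph)
  have "verts G = X \<union> Y \<and> X \<inter> Y = {} \<and> clique G X \<and> clique G Y \<and> 2 \<le> card X \<and> 2 \<le> card Y \<and>
    pairwise disjnt (edges_between G X Y) \<and> card (edges_between G X Y) = 2 \<longleftrightarrow>
    (\<exists>x1 x2 y1 y2. class_C_partition (verts G) (dominates G) X Y x1 x2 y1 y2)"
    (is "?L \<longleftrightarrow> ?R") for X Y
  proof
    assume L: ?L
    then have "X \<inter> Y = {}" by blast
    with L edges_between_matching_iff[OF this, of G] obtain x1 x2 y1 y2 where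
      "x1 \<in> X" "x2 \<in> X" "x1 \<noteq> x2" "y1 \<in> Y" "y2 \<in> Y" "y1 \<noteq> y2"
      "\<forall>s\<in>X. \<forall>t\<in>Y. s \<rightarrow>\<^bsub>G\<^esub> t \<longleftrightarrow> s = x1 \<and> t = y1 \<or> s = x2 \<and> t = y2"
      by blast
    then have "class_C_partition (verts G) (dominates G) X Y x1 x2 y1 y2"
      using L by unfold_locales (auto simp: clique_def pairwise_def)
    then show ?R by blast
  next
    assume ?R
    then obtain x1 x2 y1 y2 where
      "class_C_partition (verts G) (dominates G) X Y x1 x2 y1 y2" by blast
    then interpret class_C_partition "verts G" "dominates G" X Y x1 x2 y1 y2 .
    have "2 \<le> card X" "2 \<le> card Y"
      using card_ge_2_iff_not_singleton[of X x1] card_ge_2_iff_not_singleton[of Y y1] ends V_eq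
        finite_V
      by auto
    moreover have "pairwise disjnt (edges_between G X Y) \<and> card (edges_between G X Y) = 2"
      unfolding edges_between_matching_iff[OF disjoint] using ends across_iff by blast
    moreover have "clique G X" "clique G Y"
      using cliques V_eq unfolding clique_def pairwise_def by blast+
    ultimately show ?L using V_eq disjoint by blast
  qed
  then show ?thesis
    unfolding class_C_def adj_class_C_def using assms by simp
qed

definition induced_P5 :: "('a \<Rightarrow> 'a \<Rightarrow> bool) \<Rightarrow> 'a \<Rightarrow> 'a \<Rightarrow> 'a \<Rightarrow> 'a \<Rightarrow> 'a \<Rightarrow> bool" where
  "induced_P5 E p q r s t \<longleftrightarrow> E p q \<and> E q r \<and> E r s \<and> E s t \<and>
     \<not> E p r \<and> \<not> E p s \<and> \<not> E p t \<and> \<not> E q s \<and> \<not> E q t \<and> \<not> E r t"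

lemma (in sgraph) induced_copy_path_graph_5_iff:
  "induced_copy (parcs (path_graph 5)) E [p, q, r, s, t] \<longleftrightarrow> induced_P5 E p q r s t"
proof -
  have "sym (parcs (path_graph 5))" "irrefl (parcs (path_graph 5))"
    by (auto simp: path_graph_def sym_def irrefl_def)
  moreover have "distinct [p, q, r, s, t]" if "induced_P5 E p q r s t"
    using that irrefl by (auto simp: induced_P5_def adj_commute)
  ultimately show ?thesis
    by (auto simp: induced_copy_iff_upper All_less_eq_list_all upt_rec induced_P5_def path_graph_def
        adj_commute)
qed

lemma digraph_iso_path_graph_5_iff:
  assumes "graph G"
  shows "digraph_iso G (with_proj (path_graph 5)) \<longleftrightarrow>
    (\<exists>p q r s t. verts G = {p, q, r, s, t} \<and> induced_P5 (dominates G) p q r s t)"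
proof -
  interpret sgraph "verts G" "dominates G" using assms by (rule sgraph_of_graph)
  have path: "pair_wf_digraph (path_graph 5)" "pverts (path_graph 5) = {..<5}"
    by unfold_locales (auto simp: path_graph_def)
  have "digraph_iso G (with_proj (path_graph 5)) \<longleftrightarrow>
    (\<exists>p q r s t. set [p, q, r, s, t] = verts G \<and>
      induced_copy (parcs (path_graph 5)) (dominates G) [p, q, r, s, t])"
    unfolding digraph_iso_iff_induced_copy[OF assms path] length_eq_5_iff by metis
  then show ?thesis
    unfolding induced_copy_path_graph_5_iff list.set by metis
qed

lemma digraph_iso_path_graph_5_induce_iff:
  assumes "graph G" "S \<subseteq> verts G"
  shows "digraph_iso (G \<restriction> S) (with_proj (path_graph 5)) \<longleftrightarrow>
    (\<exists>p q r s t. S = {p, q, r, s, t} \<and> induced_P5 (dominates G) p q r s t)"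
proof -
  have "S = {p, q, r, s, t} \<and> induced_P5 (dominates (G \<restriction> S)) p q r s t \<longleftrightarrow>
      S = {p, q, r, s, t} \<and> induced_P5 (dominates G) p q r s t" for p q r s t
    unfolding induced_P5_def dominates_induce_iff by auto
  then show ?thesis
    unfolding digraph_iso_path_graph_5_iff[OF graph_induce[OF assms]] induce_subgraph_verts by simp
qed

lemma free_of_P5_induce_iff:
  assumes "graph G" "S \<subseteq> verts G"
  shows "free_of (\<lambda>H. digraph_iso H (with_proj (path_graph 5))) (G \<restriction> S) \<longleftrightarrow>
    (\<forall>p q r s t. {p, q, r, s, t} \<subseteq> S \<longrightarrow> \<not> induced_P5 (dominates G) p q r s t)"
proof -
  have iso_iff: "digraph_iso ((G \<restriction> S) \<restriction> T) (with_proj (path_graph 5)) \<longleftrightarrow>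
    (\<exists>p q r s t. T = {p, q, r, s, t} \<and> induced_P5 (dominates G) p q r s t)" if T: "T \<subseteq> S" for T
    unfolding induce_induce[OF T]
    by (rule digraph_iso_path_graph_5_induce_iff) (use assms T in auto)
  show ?thesis
    unfolding free_of_iff[OF wf_digraph_of_graph[OF graph_induce[OF assms]]] induce_subgraph_verts
  proof (intro iffI allI impI)
    fix p q r s t
    assume "\<forall>T\<subseteq>S. \<not> digraph_iso ((G \<restriction> S) \<restriction> T) (with_proj (path_graph 5))" "{p, q, r, s, t} \<subseteq> S"
    then show "\<not> induced_P5 (dominates G) p q r s t"
      using iso_iff[of "{p, q, r, s, t}"] by blast
  next
    fix T
    assume "\<forall>p q r s t. {p, q, r, s, t} \<subseteq> S \<longrightarrow> \<not> induced_P5 (dominates G) p q r s t" "T \<subseteq> S"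
    then show "\<not> digraph_iso ((G \<restriction> S) \<restriction> T) (with_proj (path_graph 5))"
      unfolding iso_iff[OF \<open>T \<subseteq> S\<close>] by metis
  qed
qed

lemma (in sgraph) P5_free_iff_no_2K2_across:
  assumes X: "stable_in E X" and Y: "stable_in E Y" and disjoint: "X \<inter> Y = {}"
    and x: "x \<in> X" "\<And>v. v \<in> Y \<Longrightarrow> E x v"
  shows "(\<forall>p q r s t. {p, q, r, s, t} \<subseteq> X \<union> Y \<longrightarrow> \<not> induced_P5 E p q r s t) \<longleftrightarrow>
    (\<forall>p\<in>X. \<forall>r\<in>X. \<forall>q\<in>Y. \<forall>s\<in>Y. \<not> induced_2K2 E p q r s)"
proof (intro iffI allI impI ballI notI)
  fix p r q s
  assume P5_free: "\<forall>p q r s t. {p, q, r, s, t} \<subseteq> X \<union> Y \<longrightarrow> \<not> induced_P5 E p q r s t"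
    and mem: "p \<in> X" "r \<in> X" "q \<in> Y" "s \<in> Y" and two_K2: "induced_2K2 E p q r s"
  have "\<not> E p x" "\<not> E x r" "E q x" "E x s"
    using X mem x sym unfolding stable_in_def by blast+
  then have "induced_P5 E p q x s r"
    using two_K2 sym unfolding induced_P5_def induced_2K2_def by blast
  then show False using P5_free mem x(1) by blast
next
  fix p q r s t
  assume no_2K2: "\<forall>p\<in>X. \<forall>r\<in>X. \<forall>q\<in>Y. \<forall>s\<in>Y. \<not> induced_2K2 E p q r s"
    and sub: "{p, q, r, s, t} \<subseteq> X \<union> Y" and P5: "induced_P5 E p q r s t"
  have "bipartition E (X \<union> Y) X"
    using X Y disjoint unfolding bipartition_def stable_in_def by blast
  note side = bipartitionD[OF this]
  have "p \<in> X \<longleftrightarrow> q \<notin> X" "q \<in> X \<longleftrightarrow> r \<notin> X" "r \<in> X \<longleftrightarrow> s \<notin> X" "s \<in> X \<longleftrightarrow> t \<notin> X"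
    using P5 sub unfolding induced_P5_def by (intro side; blast)+
  then consider "p \<in> X" "q \<in> Y" "s \<in> Y" "t \<in> X" | "p \<in> Y" "q \<in> X" "s \<in> X" "t \<in> Y"
    using sub by blast
  moreover have "induced_2K2 E p q t s" "induced_2K2 E q p s t"
    using P5 sym unfolding induced_P5_def induced_2K2_def by blast+
  ultimately show False
    using no_2K2 by cases blast+
qed

lemma connected_induce_if_spanning_edge:
  assumes G: "graph G" and S: "S \<subseteq> verts G" and xy: "x \<in> S" "y \<in> S" "x \<rightarrow>\<^bsub>G\<^esub> y"
    and adj: "\<And>v. v \<in> S \<Longrightarrow> x \<rightarrow>\<^bsub>G\<^esub> v \<or> y \<rightarrow>\<^bsub>G\<^esub> v"
  shows "connected (G \<restriction> S)"
proof -
  let ?H = "G \<restriction> S"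
  interpret H: graph ?H by (rule graph_induce[OF G S])
  have xv: "x \<rightarrow>\<^sup>*\<^bsub>?H\<^esub> v" if "v \<in> S" for v
    using adj[OF that] xy that H.reachable_adjI[of x v] H.adj_reachable_trans[of x y v]
      H.reachable_adjI[of y v]
    by (auto simp: dominates_induce_iff)
  have vx: "v \<rightarrow>\<^sup>*\<^bsub>?H\<^esub> x" if "v \<in> S" for v
    using H.symmetric_reachable'[OF xv[OF that]] .
  have "u \<rightarrow>\<^sup>*\<^bsub>?H\<^esub> v" if "u \<in> S" "v \<in> S" for u v
    using vx[OF that(1)] xv[OF that(2)] by (rule H.reachable_trans)
  moreover have "symcl (arcs_ends ?H) = arcs_ends ?H"
    using H.graph_symmetric by (auto simp: symcl_def)
  ultimately show ?thesis
    using xy by (auto simp: connected_conv reachable_def)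
qed

lemma bipartite_induce_Un:
  assumes "graph G" "X \<inter> Y = {}" "stable G X" "stable G Y"
  shows "bipartite (G \<restriction> (X \<union> Y))"
proof -
  have "graph (G \<restriction> (X \<union> Y))"
    using assms by (intro graph_induce) (auto simp: stable_def)
  moreover have "stable (G \<restriction> (X \<union> Y)) X" "stable (G \<restriction> (X \<union> Y)) Y"
    using assms(3,4) unfolding stable_def dominates_induce_iff induce_subgraph_verts by blast+
  ultimately show ?thesis
    unfolding bipartite_def using assms(2) by (intro conjI exI[of _ X] exI[of _ Y]) simp_all
qed

lemma free_of_P5_induce_Un_iff:
  assumes "graph G" "X \<inter> Y = {}" "stable G X" "stable G Y" "x \<in> X" "complete_to G {x} Y"
  shows "free_of (\<lambda>H. digraph_iso H (with_proj (path_graph 5))) (G \<restriction> (X \<union> Y)) \<longleftrightarrow>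
    (\<forall>p r q s. p \<in> X \<longrightarrow> r \<in> X \<longrightarrow> q \<in> Y \<longrightarrow> s \<in> Y \<longrightarrow> \<not> induced_2K2 (dominates G) p q r s)"
proof -
  interpret sgraph "verts G" "dominates G" using assms(1) by (rule sgraph_of_graph)
  have "X \<union> Y \<subseteq> verts G" "stable_in (dominates G) X" "stable_in (dominates G) Y"
    using assms(3,4) unfolding stable_def stable_in_def by blast+
  then show ?thesis
    using free_of_P5_induce_iff[OF assms(1), of "X \<union> Y"] P5_free_iff_no_2K2_across[of X Y x] assms
    by (auto simp: complete_to_def)
qed

lemma class_B_partition_iff:
  assumes "graph G"
  shows "class_B_partition (verts G) (dominates G) X Y Z W x y \<longleftrightarrow>
    verts G = X \<union> Y \<union> Z \<union> W \<and>
    X \<inter> Y = {} \<and> X \<inter> Z = {} \<and> X \<inter> W = {} \<and> Y \<inter> Z = {} \<and> Y \<inter> W = {} \<and> Z \<inter> W = {} \<and>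
    stable G X \<and> stable G Y \<and> stable G Z \<and> stable G W \<and>
    x \<in> X \<and> y \<in> Y \<and> 2 \<le> card X \<and> 2 \<le> card Y \<and>
    connected (G \<restriction> (X \<union> Y)) \<and> bipartite (G \<restriction> (X \<union> Y)) \<and>
    free_of (\<lambda>H. digraph_iso H (with_proj (path_graph 5))) (G \<restriction> (X \<union> Y)) \<and>
    anticomplete_to G W (X \<union> Y \<union> Z) \<and>
    complete_to G {x} Y \<and> complete_to G {y} X \<and>
    complete_to G Z {x, y} \<and> anticomplete_to G Z ((X \<union> Y) - {x, y})"
proof (cases "verts G = X \<union> Y \<union> Z \<union> W \<and> X \<inter> Y = {} \<and>
    stable_in (dominates G) X \<and> stable_in (dominates G) Y \<and>
    x \<in> X \<and> y \<in> Y \<and> complete_to G {x} Y \<and> complete_to G {y} X")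
  case True
  interpret sgraph "verts G" "dominates G" using assms by (rule sgraph_of_graph)
  have "X \<subseteq> verts G" "Y \<subseteq> verts G" "Z \<subseteq> verts G" "W \<subseteq> verts G"
    and sub: "X \<union> Y \<subseteq> verts G" and V_eq: "verts G = X \<union> Y \<union> Z \<union> W"
    using True by blast+
  then have stable: "stable G X" "stable G Y" "stable G Z \<longleftrightarrow> stable_in (dominates G) Z"
    using True unfolding stable_def stable_in_def by blast+
  have connected: "connected (G \<restriction> (X \<union> Y))"
    by (rule connected_induce_if_spanning_edge[OF assms sub, of x y])
      (use True in \<open>auto simp: complete_to_def\<close>)
  have disjoint: "X \<inter> Y = {}" and x: "x \<in> X" "complete_to G {x} Y" using True by blast+
  note bipartite = bipartite_induce_Un[OF assms disjoint stable(1,2)]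
    and P5_iff = free_of_P5_induce_Un_iff[OF assms disjoint stable(1,2) x]
  have card_iff: "2 \<le> card X \<longleftrightarrow> X \<noteq> {x}" "2 \<le> card Y \<longleftrightarrow> Y \<noteq> {y}"
    using True sub by (auto intro!: card_ge_2_iff_not_singleton intro: finite_subset finite_V)
  have W_iff: "(\<forall>w v. w \<in> W \<longrightarrow> v \<in> verts G \<longrightarrow> \<not> w \<rightarrow>\<^bsub>G\<^esub> v) \<longleftrightarrow>
    stable G W \<and> anticomplete_to G W (X \<union> Y \<union> Z)"
    unfolding V_eq stable_def anticomplete_to_def by blast
  have Z_iff: "(\<forall>z. z \<in> Z \<longrightarrow> z \<rightarrow>\<^bsub>G\<^esub> x \<and> z \<rightarrow>\<^bsub>G\<^esub> y) \<longleftrightarrow> complete_to G Z {x, y}"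
    "(\<forall>z v. z \<in> Z \<longrightarrow> v \<in> X \<union> Y - {x, y} \<longrightarrow> \<not> z \<rightarrow>\<^bsub>G\<^esub> v) \<longleftrightarrow>
      anticomplete_to G Z (X \<union> Y - {x, y})"
    unfolding complete_to_def anticomplete_to_def by blast+
  have "\<forall>v. v \<in> Y \<longrightarrow> x \<rightarrow>\<^bsub>G\<^esub> v" "\<forall>u. u \<in> X \<longrightarrow> y \<rightarrow>\<^bsub>G\<^esub> u"
    using True unfolding complete_to_def by blast+
  then show ?thesis
    unfolding class_B_partition_def class_B_partition_axioms_def P5_iff card_iff W_iff Z_iff
    using True connected bipartite stable sgraph_axioms by argo
next
  case False
  have "stable G X \<longrightarrow> stable_in (dominates G) X" "stable G Y \<longrightarrow> stable_in (dominates G) Y"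
    unfolding stable_def stable_in_def by blast+
  moreover have "(\<forall>v. v \<in> Y \<longrightarrow> x \<rightarrow>\<^bsub>G\<^esub> v) \<longleftrightarrow> complete_to G {x} Y"
    "(\<forall>u. u \<in> X \<longrightarrow> y \<rightarrow>\<^bsub>G\<^esub> u) \<longleftrightarrow> complete_to G {y} X"
    unfolding complete_to_def by blast+
  ultimately show ?thesis
    unfolding class_B_partition_def class_B_partition_axioms_def using False by argo
qed

lemma class_B_iff:
  assumes "graph G"
  shows "class_B G \<longleftrightarrow> adj_class_B (verts G) (dominates G)"
  unfolding class_B_def adj_class_B_def class_B_partition_iff[OF assms] using assms by simp

lemma basic_iff:
  assumes "graph G"
  shows "basic G \<longleftrightarrow> adj_basic (verts G) (dominates G)"
  unfolding basic_def adj_basic_def is_hole_5_iff[OF assms] is_hole_6_iff[OF assms]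
    split_graph_iff[OF assms] class_A_iff[OF assms] class_B_iff[OF assms] class_C_iff[OF assms]
  by blast

theorem theorem3:
  fixes G :: "('a,'b) pre_digraph"
  assumes "graph G"
  shows "(free_of (\<lambda>H. is_wheel H \<or> is_antiwheel H) G \<longleftrightarrow>
          free_of (\<lambda>H. card (verts H) \<le> 7 \<and> (is_wheel H \<or> is_antiwheel H)) G)
       \<and> (free_of (\<lambda>H. card (verts H) \<le> 7 \<and> (is_wheel H \<or> is_antiwheel H)) G \<longleftrightarrow>
          basic G \<or> basic (complement G))"
proof -
  interpret sgraph "verts G" "dominates G" using assms by (rule sgraph_of_graph)
  have "free_of (\<lambda>H. is_wheel H \<or> is_antiwheel H) G \<longleftrightarrow> small_wheel_rules (verts G) (dominates G)"
    using free_of_wheel_antiwheel_iff[OF assms, of "\<lambda>_. True"] small_wheel_rules_iff_no_wheel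
    by simp
  moreover have "free_of (\<lambda>H. card (verts H) \<le> 7 \<and> (is_wheel H \<or> is_antiwheel H)) G \<longleftrightarrow>
      small_wheel_rules (verts G) (dominates G)"
    using free_of_wheel_antiwheel_iff[OF assms, of "\<lambda>n. n \<le> 7"] small_wheel_rules_iff_no_small_wheel
    by simp
  moreover have "basic G \<or> basic (complement G) \<longleftrightarrow> small_wheel_rules (verts G) (dominates G)"
    unfolding small_wheel_rules_iff_adj_basic basic_iff[OF assms]
      basic_iff[OF graph_complement[OF assms]] verts_complement dominates_complement ..
  ultimately show ?thesis by blast
qed

end
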